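(* Let $n\ge1$ be an integer, $\beta>0$, $u\in H^n(\Lambda)$ and $N\ge n$ an integer. Then $$\partial_x^{\ell}\pi^{-n,\beta}_Nu(0)=\partial_x^{\ell}u(0),\qquad \ell=0,1,\dots,n-1;$$ in other words, $u-\pi^{-n,\beta}_Nu\in H^n_0(\Lambda)$.
   Context: $\Lambda=(0,\infty)$ and $(\cdot,\cdot)$ is the $L^2(\Lambda)$ inner product. $X^{\beta}_N=\{e^{-\frac12\beta x}p(x):p\text{ a real polynomial of degree}\le N\}$. The projection $\pi^{-n,\beta}_N:H^n(\Lambda)\to X^{\beta}_N$ is the orthogonal projection defined by $a^{-n,\beta}_n(u-\pi^{-n,\beta}_Nu,v)=0$ for all $v\in X^{\beta}_N$, where $$a^{-n,\beta}_n(u,v)=\sum_{\nu=0}^{n}\binom{n}{\nu}\frac{\beta^{2n-2\nu}}{2^{2n-2\nu}}(\partial_x^{\nu}u,\partial_x^{\nu}v).$$ $H^n_0(\Lambda)$ is the subspace of $v\in H^n(\Lambda)$ with $\partial_x^{\ell}v(0)=0$ for $0\le\ell\le n-1$. *)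

theory Defs
  imports "HOL-Analysis.Analysis"
begin

text \<open>
  Functions on the half-line are represented by functions \<open>real \<Rightarrow> real\<close> of which only the values
  on \<open>{0<..}\<close>, up to a Lebesgue null set, matter.
\<close>

abbreviation half_line :: "real set" where
  "half_line \<equiv> {0<..}"

definition L2 :: "(real \<Rightarrow> real) set" where
  "L2 = {u. u \<in> borel_measurable (lebesgue_on half_line) \<and>
            integrable (lebesgue_on half_line) (\<lambda>x. (u x)\<^sup>2)}"

definition L2_inner :: "(real \<Rightarrow> real) \<Rightarrow> (real \<Rightarrow> real) \<Rightarrow> real" where
  "L2_inner u v = (LINT x|lebesgue_on half_line. u x * v x)"

definition locally_integrable :: "(real \<Rightarrow> real) \<Rightarrow> bool" where
  "locally_integrable u \<longleftrightarrow>
     (\<forall>K. compact K \<and> K \<subseteq> half_line \<longrightarrow> integrable (lebesgue_on K) u)"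

text \<open>Smooth functions with compact support contained in the open half-line.\<close>

definition test_functions :: "(real \<Rightarrow> real) set" where
  "test_functions =
     {\<phi>. (\<forall>k. ((deriv ^^ k) \<phi>) differentiable_on UNIV) \<and>
         compact (closure {x. \<phi> x \<noteq> 0}) \<and> closure {x. \<phi> x \<noteq> 0} \<subseteq> half_line}"

definition has_weak_deriv :: "nat \<Rightarrow> (real \<Rightarrow> real) \<Rightarrow> (real \<Rightarrow> real) \<Rightarrow> bool" where
  "has_weak_deriv k u v \<longleftrightarrow>
     locally_integrable u \<and> locally_integrable v \<and>
     (\<forall>\<phi>\<in>test_functions.
        (LINT x|lebesgue_on half_line. u x * (deriv ^^ k) \<phi> x) =
        (-1) ^ k * (LINT x|lebesgue_on half_line. v x * \<phi> x))"

text \<open>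
  The weak derivative is unique only almost everywhere on the half-line, so this selects a
  representative. All uses below are invariant under changes on null sets.
\<close>

definition weak_deriv :: "nat \<Rightarrow> (real \<Rightarrow> real) \<Rightarrow> real \<Rightarrow> real" where
  "weak_deriv k u = (SOME v. has_weak_deriv k u v)"

definition sobolev :: "nat \<Rightarrow> (real \<Rightarrow> real) set" where
  "sobolev n = {u \<in> L2. \<forall>k\<le>n. \<exists>v\<in>L2. has_weak_deriv k u v}"

text \<open>
  The value at the endpoint 0 of an almost-everywhere class is that of its representative which is
  continuous on the closed half-line. There is at most one such \<open>c\<close>.
\<close>

definition has_value_at_0 :: "(real \<Rightarrow> real) \<Rightarrow> real \<Rightarrow> bool" where
  "has_value_at_0 u c \<longleftrightarrow>
     (\<exists>g. continuous_on {0..} g \<and> (AE x in lebesgue_on half_line. u x = g x) \<and> g 0 = c)"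

definition sobolev_0 :: "nat \<Rightarrow> (real \<Rightarrow> real) set" where
  "sobolev_0 n = {v \<in> sobolev n. \<forall>l<n. has_value_at_0 (weak_deriv l v) 0}"

definition laguerre_space :: "real \<Rightarrow> nat \<Rightarrow> (real \<Rightarrow> real) set" where
  "laguerre_space \<beta> N = {\<lambda>x. exp (- (1/2) * \<beta> * x) * poly p x | p. degree p \<le> N}"

definition sobolev_form ::
    "real \<Rightarrow> nat \<Rightarrow> (real \<Rightarrow> real) \<Rightarrow> (real \<Rightarrow> real) \<Rightarrow> real" where
  "sobolev_form \<beta> n u v =
     (\<Sum>\<nu>=0..n. real (n choose \<nu>) * (\<beta> ^ (2 * n - 2 * \<nu>) / 2 ^ (2 * n - 2 * \<nu>)) *
        L2_inner (weak_deriv \<nu> u) (weak_deriv \<nu> v))"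

text \<open>
  The elements of \<open>laguerre_space \<beta> N\<close> are genuine functions, determined by their values on the
  half-line, so the definite description is not affected by null sets.
\<close>

definition projection :: "nat \<Rightarrow> real \<Rightarrow> nat \<Rightarrow> (real \<Rightarrow> real) \<Rightarrow> real \<Rightarrow> real" where
  "projection n \<beta> N u =
     (THE w. w \<in> laguerre_space \<beta> N \<and>
             (\<forall>v\<in>laguerre_space \<beta> N. sobolev_form \<beta> n (\<lambda>x. u x - w x) v = 0))"

end

theory Submission
  imports Defs
begin

text \<open>
  Let \<open>f\<close> be the difference of \<open>u\<close> and its projection, and let \<open>X\<close> be the space of functions
  \<open>exp (- \<beta> x / 2) p\<close> with \<open>p\<close> of degree below \<open>n\<close>. Formally the form belongs to the operator
  \<open>((\<beta>/2)^2 - D^2)^n\<close> with \<open>D\<close> the derivative. On the polynomial factor \<open>p\<close> the operator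
  \<open>(\<beta>/2)^2 - D^2\<close> acts as \<open>\<beta> p' - p''\<close>, which lowers the degree, so the \<open>n\<close>-th power annihilates
  \<open>X\<close> (\<open>exp_poly_ode\<close>). Integrating by parts, the form therefore pairs to zero each \<open>z\<close> in \<open>X\<close> with
  each function whose derivatives of order below \<open>n\<close> vanish at 0.

  Initial values of order below \<open>n\<close> can be prescribed arbitrarily in \<open>X\<close>
  (\<open>exp_poly_initial_values\<close>). Choose \<open>z\<close> in \<open>X\<close> with the initial values of \<open>f\<close>. Then the form pairs
  \<open>f - z\<close> with \<open>z\<close> to zero, and also \<open>f\<close> with \<open>z\<close>, because \<open>X\<close> is contained in the space that is
  projected onto. So it vanishes on the pair of \<open>z\<close> with itself. As \<open>\<beta> > 0\<close>, the form is positive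
  definite, whence \<open>z = 0\<close> and all the initial values of \<open>f\<close> vanish (\<open>orthogonal_vanishes_at_0\<close>).

  Initial values of weak derivatives make sense because a function in \<open>L2\<close> with weak derivative \<open>v\<close>
  in \<open>L2\<close> is almost everywhere a constant plus the primitive of \<open>v\<close>
  (\<open>sobolev_primitive\<close>). This rests on the lemma of du Bois-Reymond, hence on a supply of smooth bump
  functions, and on integration by parts for such primitives, which is an application of Fubini's
  theorem (\<open>integration_by_parts\<close>). The projection exists by the Gram-Schmidt process and is unique because
  the form is definite (\<open>projection_exp_poly\<close>).
\<close>

section \<open>Smooth functions and test functions\<close>

definition smooth :: "(real \<Rightarrow> real) \<Rightarrow> bool" where
  "smooth f \<longleftrightarrow> (\<forall>k. ((deriv ^^ k) f) differentiable_on UNIV)"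

text \<open>
  Differentiating repeatedly never leaves a set that is closed under differentiation, so
  smoothness can be shown by exhibiting such a set. This avoids every explicit formula for a
  higher derivative, in particular the Leibniz rule.
\<close>

lemma smooth_coinduct:
  assumes "f \<in> S"
    and step: "\<And>g. g \<in> S \<Longrightarrow> \<exists>g'\<in>S. \<forall>x. (g has_real_derivative g' x) (at x)"
  shows "smooth f"
  unfolding smooth_def
proof
  fix k
  have der: "deriv g \<in> S" if g: "g \<in> S" for g
  proof -
    obtain g' where g': "g' \<in> S" "\<forall>x. (g has_real_derivative g' x) (at x)"
      using step[OF g] by blast
    have "deriv g = g'"
      by (rule ext) (use g' DERIV_imp_deriv in blast)
    then show ?thesis using g' by simp
  qed
  have "(deriv ^^ k) f \<in> S" for k
    by (induction k) (use assms(1) der in auto)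
  then obtain g' where "\<forall>x. ((deriv ^^ k) f has_real_derivative g' x) (at x)"
    using step by blast
  then show "((deriv ^^ k) f) differentiable_on UNIV"
    unfolding differentiable_on_def
    by (metis at_within_open open_UNIV UNIV_I real_differentiable_def)
qed

lemma smooth_has_deriv:
  assumes "smooth f"
  shows "(f has_real_derivative deriv f x) (at x)"
proof -
  have "((deriv ^^ 0) f) differentiable_on UNIV"
    using assms unfolding smooth_def by blast
  then have "f differentiable (at x)"
    by (simp add: differentiable_on_def)
  then show ?thesis
    by (metis DERIV_imp_deriv real_differentiable_def)
qed

lemma smooth_deriv: "smooth f \<Longrightarrow> smooth (deriv f)"
  unfolding smooth_def by (metis funpow_swap1 funpow.simps(2) comp_apply)

lemma smooth_antideriv:
  assumes "\<And>x. (F has_real_derivative f x) (at x)" "smooth f"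
  shows "smooth F"
proof (rule smooth_coinduct[of _ "insert F {g. smooth g}"])
  show "\<exists>g'\<in>insert F {g. smooth g}. \<forall>x. (g has_real_derivative g' x) (at x)"
    if "g \<in> insert F {g. smooth g}" for g
    using that assms smooth_has_deriv smooth_deriv by blast
qed simp

lemma smooth_continuous_on: "smooth f \<Longrightarrow> continuous_on A f"
  by (meson DERIV_continuous_on has_field_derivative_at_within smooth_has_deriv)

text \<open>
  By the sum and product rules, the algebra generated by the smooth functions is closed under
  differentiation. By coinduction it contains smooth functions only.
\<close>

inductive_set smooth_algebra :: "(real \<Rightarrow> real) set" where
  base: "smooth f \<Longrightarrow> f \<in> smooth_algebra"
| add: "f \<in> smooth_algebra \<Longrightarrow> g \<in> smooth_algebra \<Longrightarrow> (\<lambda>x. f x + g x) \<in> smooth_algebra"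
| mult: "f \<in> smooth_algebra \<Longrightarrow> g \<in> smooth_algebra \<Longrightarrow> (\<lambda>x. f x * g x) \<in> smooth_algebra"

lemma smooth_algebra_smooth:
  assumes "f \<in> smooth_algebra" shows "smooth f"
proof (rule smooth_coinduct[OF assms])
  fix g assume "g \<in> smooth_algebra"
  then show "\<exists>g'\<in>smooth_algebra. \<forall>x. (g has_real_derivative g' x) (at x)"
  proof induction
    case (base f)
    then show ?case using smooth_has_deriv smooth_deriv smooth_algebra.base by blast
  next
    case (add f g)
    then obtain f' g' where "f' \<in> smooth_algebra" "g' \<in> smooth_algebra"
      "\<forall>x. (f has_real_derivative f' x) (at x)" "\<forall>x. (g has_real_derivative g' x) (at x)" by blast
    then show ?case
      by (intro bexI[of _ "\<lambda>x. f' x + g' x"]) (auto intro: smooth_algebra.add DERIV_add)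
  next
    case (mult f g)
    then obtain f' g' where "f' \<in> smooth_algebra" "g' \<in> smooth_algebra"
      "\<forall>x. (f has_real_derivative f' x) (at x)" "\<forall>x. (g has_real_derivative g' x) (at x)" by blast
    then show ?case
      using mult.hyps
      by (intro bexI[of _ "\<lambda>x. f' x * g x + g' x * f x"])
        (auto intro!: smooth_algebra.add smooth_algebra.mult DERIV_mult)
  qed
qed

lemma smooth_add: "smooth f \<Longrightarrow> smooth g \<Longrightarrow> smooth (\<lambda>x. f x + g x)"
  and smooth_mult: "smooth f \<Longrightarrow> smooth g \<Longrightarrow> smooth (\<lambda>x. f x * g x)"
  by (simp_all add: smooth_algebra_smooth smooth_algebra.intros)

lemma smooth_const: "smooth (\<lambda>x. c)"
  by (rule smooth_coinduct[of _ "range (\<lambda>c x. c)"]) (auto intro!: exI[of _ 0])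

lemma smooth_compose_affine:
  assumes "smooth f" shows "smooth (\<lambda>x. f (a * x + b))"
proof (rule smooth_coinduct[of _ "{\<lambda>x. c * f (a * x + b) | c f. smooth f}"])
  show "(\<lambda>x. f (a * x + b)) \<in> {\<lambda>x. c * f (a * x + b) | c f. smooth f}"
    using assms by (intro CollectI exI[of _ 1] exI[of _ f]) auto
next
  fix g assume "g \<in> {\<lambda>x. c * f (a * x + b) | c f. smooth f}"
  then obtain c f where g: "g = (\<lambda>x. c * f (a * x + b))" and f: "smooth f" by blast
  have "(g has_real_derivative (c * a) * deriv f (a * x + b)) (at x)" for x
  proof -
    have "((\<lambda>x. a * x + b) has_real_derivative a) (at x)"
      by (auto intro!: derivative_eq_intros)
    from DERIV_cmult[OF DERIV_chain2[OF smooth_has_deriv[OF f] this], of c]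
    show ?thesis unfolding g by (simp add: mult_ac)
  qed
  then show "\<exists>g'\<in>{\<lambda>x. c * f (a * x + b) | c f. smooth f}.
      \<forall>x. (g has_real_derivative g' x) (at x)"
    using smooth_deriv[OF f] by (intro bexI[of _ "\<lambda>x. c * a * deriv f (a * x + b)"]) auto
qed

text \<open>
  With \<open>P = 1\<close> this is the classical smooth function that is flat at 0. The
  polynomial \<open>P\<close> in \<open>1 / x\<close> makes the family closed under
  differentiation.
\<close>

definition flat_exp :: "real poly \<Rightarrow> real \<Rightarrow> real" where
  "flat_exp P x = (if x > 0 then poly P (1 / x) * exp (- (1 / x)) else 0)"

lemma poly_times_exp_neg_tendsto_0:
  "((\<lambda>y::real. poly P y * exp (- y)) \<longlongrightarrow> 0) at_top"
proof -
  have "((\<lambda>y. \<Sum>i\<le>degree P. coeff P i * (y ^ i / exp y)) \<longlongrightarrow> (\<Sum>i\<le>degree P. coeff P i * 0)) at_top"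
    by (intro tendsto_intros tendsto_power_div_exp_0)
  then show ?thesis
    by (simp add: poly_altdef sum_distrib_right exp_minus divide_inverse mult.assoc)
qed

lemma flat_exp_has_deriv:
  "(flat_exp P has_real_derivative flat_exp ([:0, 0, 1:] * (P - pderiv P)) x) (at x)"
proof -
  consider "x > 0" | "x < 0" | "x = 0" by linarith
  then show ?thesis
  proof cases
    case 1
    have "((\<lambda>x. poly P (1 / x) * exp (- (1 / x))) has_real_derivative
        flat_exp ([:0, 0, 1:] * (P - pderiv P)) x) (at x)"
      using 1 unfolding flat_exp_def
      by (auto intro!: derivative_eq_intros DERIV_chain2[OF poly_DERIV] simp: field_simps power2_eq_square)
    then show ?thesis
      by (rule has_field_derivative_transform_within_open[of _ _ _ "{0<..}"])
        (use 1 in \<open>auto simp: flat_exp_def\<close>)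
  next
    case 2
    have "((\<lambda>x. 0) has_real_derivative flat_exp ([:0, 0, 1:] * (P - pderiv P)) x) (at x)"
      using 2 unfolding flat_exp_def by simp
    then show ?thesis
      by (rule has_field_derivative_transform_within_open[of _ _ _ "{..<0}"])
        (use 2 in \<open>auto simp: flat_exp_def\<close>)
  next
    case 3
    \<comment> \<open>Substituting \<open>y = 1 / h\<close>, the exponential beats the polynomial as \<open>y\<close> grows.\<close>
    have "((\<lambda>h. flat_exp P h / h) \<longlongrightarrow> 0) (at_right 0)"
      unfolding filterlim_at_right_to_top
    proof (rule Lim_transform_eventually)
      show "((\<lambda>y::real. poly (P * [:0, 1:]) y * exp (- y)) \<longlongrightarrow> 0) at_top"
        by (rule poly_times_exp_neg_tendsto_0)
      show "\<forall>\<^sub>F y in at_top. poly (P * [:0, 1:]) y * exp (- y)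
          = flat_exp P (inverse y) / inverse y"
        using eventually_gt_at_top[of 0]
        by eventually_elim (auto simp: flat_exp_def field_simps)
    qed
    moreover have "((\<lambda>h. flat_exp P h / h) \<longlongrightarrow> 0) (at_left 0)"
      by (rule Lim_transform_eventually[OF tendsto_const])
        (auto simp: flat_exp_def eventually_at_filter)
    ultimately have "((\<lambda>h. flat_exp P h / h) \<longlongrightarrow> 0) (at 0)"
      by (simp add: filterlim_split_at)
    then show ?thesis
      using 3 by (simp add: DERIV_def flat_exp_def)
  qed
qed

lemma smooth_flat_exp: "smooth (flat_exp P)"
  by (rule smooth_coinduct[of _ "range flat_exp"]) (use flat_exp_has_deriv in blast)+

text \<open>
  As \<open>m\<close> grows these test functions increase to the indicator function of the open
  interval from \<open>a\<close> to \<open>b\<close>.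
\<close>

definition bump :: "real \<Rightarrow> real \<Rightarrow> real \<Rightarrow> real \<Rightarrow> real" where
  "bump a b m x = flat_exp 1 (m * (x - a)) * flat_exp 1 (m * (b - x))"

lemma test_functionsI:
  assumes "smooth f" "0 < a" "\<And>x. x \<notin> {a..b} \<Longrightarrow> f x = 0"
  shows "f \<in> test_functions"
proof -
  have "closure {x. f x \<noteq> 0} \<subseteq> {a..b}"
    by (rule closure_minimal) (use assms(3) in blast, rule closed_atLeastAtMost)
  moreover from this have "compact (closure {x. f x \<noteq> 0})"
    by (meson closed_closure bounded_closed_interval bounded_subset compact_eq_bounded_closed)
  moreover have "{a..b} \<subseteq> half_line"
    using assms(2) by auto
  ultimately show ?thesis
    using assms(1) unfolding test_functions_def smooth_def by blast
qed

lemma test_functionsE: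
  assumes "f \<in> test_functions"
  obtains a b where "smooth f" "0 < a" "a < b" "\<And>x. x \<notin> {a..b} \<Longrightarrow> f x = 0"
proof -
  let ?K = "closure {x. f x \<noteq> 0}"
  have K: "smooth f" "compact ?K" "?K \<subseteq> {0<..}"
    using assms unfolding test_functions_def smooth_def by auto
  show ?thesis
  proof (cases "?K = {}")
    case True
    then have "f x = 0" for x using closure_subset[of "{x. f x \<noteq> 0}"] by blast
    then show ?thesis using K that[of 1 2] by simp
  next
    case False
    obtain a where a: "a \<in> ?K" "\<And>x. x \<in> ?K \<Longrightarrow> a \<le> x"
      using compact_attains_inf[OF K(2) False] by blast
    obtain b where b: "b \<in> ?K" "\<And>x. x \<in> ?K \<Longrightarrow> x \<le> b"
      using compact_attains_sup[OF K(2) False] by blast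
    have "f x = 0" if "x \<notin> {a..b + 1}" for x
    proof (rule ccontr)
      assume "f x \<noteq> 0"
      then have "x \<in> ?K" using closure_subset by fastforce
      then show False using a(2) b(2) that by force
    qed
    moreover have "0 < a" "a < b + 1" using a b K(3) by fastforce+
    ultimately show ?thesis using that K(1) by blast
  qed
qed

lemma test_function_deriv:
  assumes "f \<in> test_functions" shows "deriv f \<in> test_functions"
proof -
  obtain a b where f: "smooth f" "0 < a" "a < b" "\<And>x. x \<notin> {a..b} \<Longrightarrow> f x = 0"
    using test_functionsE[OF assms] by blast
  have "deriv f x = 0" if "x \<notin> {a..b}" for x
  proof (rule DERIV_imp_deriv)
    show "(f has_real_derivative 0) (at x)"
      by (rule has_field_derivative_transform_within_open[of "\<lambda>x. 0" _ _ "- {a..b}"])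
        (use that f in \<open>auto intro: open_Compl\<close>)
  qed
  then show ?thesis
    using f smooth_deriv test_functionsI by blast
qed

lemma test_function_funpow_deriv: "f \<in> test_functions \<Longrightarrow> (deriv ^^ k) f \<in> test_functions"
  by (induction k) (auto intro: test_function_deriv)

lemma test_function_bump:
  assumes "0 < a" "0 < m" shows "bump a b m \<in> test_functions"
proof (rule test_functionsI)
  have eq: "bump a b m = (\<lambda>x. flat_exp 1 (m * x + (- m * a)) * flat_exp 1 ((- m) * x + m * b))"
    by (auto simp: bump_def algebra_simps)
  show "smooth (bump a b m)"
    unfolding eq by (intro smooth_mult smooth_compose_affine smooth_flat_exp)
  show "bump a b m x = 0" if "x \<notin> {a..b}" for x
    using that assms by (auto simp: bump_def flat_exp_def zero_less_mult_iff)
qed fact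

lemma bump_bounds: "0 \<le> bump a b m x" "bump a b m x \<le> 1"
  by (auto simp: bump_def flat_exp_def intro!: mult_le_one)

lemma bump_tendsto_indicator:
  "(\<lambda>j. bump a b (real (Suc j)) x) \<longlonglongrightarrow> indicator {a<..<b} x"
proof (cases "x \<in> {a<..<b}")
  case True
  have *: "(\<lambda>j. flat_exp 1 (real (Suc j) * t)) \<longlonglongrightarrow> 1" if "t > 0" for t
  proof -
    have "(\<lambda>j. exp (- (1 / t) * inverse (real (Suc j)))) \<longlonglongrightarrow> exp (- (1 / t) * 0)"
      by (intro tendsto_intros LIMSEQ_inverse_real_of_nat)
    then show ?thesis
      using that by (simp add: flat_exp_def divide_inverse mult_ac)
  qed
  have "(\<lambda>j. bump a b (real (Suc j)) x) \<longlonglongrightarrow> 1 * 1"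
    unfolding bump_def using True by (intro tendsto_mult *) auto
  then show ?thesis using True by simp
next
  case False
  then have "bump a b (real (Suc j)) x = 0" for j
    by (auto simp: bump_def flat_exp_def zero_less_mult_iff)
  then show ?thesis using False by simp
qed

lemma test_function_diff_scale:
  assumes "f \<in> test_functions" "g \<in> test_functions"
  shows "(\<lambda>x. f x - c * g x) \<in> test_functions"
proof -
  obtain a b where f: "smooth f" "0 < a" "a < b" "\<And>x. x \<notin> {a..b} \<Longrightarrow> f x = 0"
    using test_functionsE[OF assms(1)] by blast
  obtain a' b' where g: "smooth g" "0 < a'" "a' < b'" "\<And>x. x \<notin> {a'..b'} \<Longrightarrow> g x = 0"
    using test_functionsE[OF assms(2)] by blast
  show ?thesis
  proof (rule test_functionsI[of _ "min a a'" "max b b'"])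
    have "smooth (\<lambda>x. f x + (\<lambda>x. - c) x * g x)"
      by (intro smooth_add smooth_mult smooth_const f g)
    then show "smooth (\<lambda>x. f x - c * g x)" by simp
    show "f x - c * g x = 0" if "x \<notin> {min a a'..max b b'}" for x
    proof -
      have "x \<notin> {a..b}" "x \<notin> {a'..b'}" using that by auto
      then show ?thesis using f(4) g(4) by simp
    qed
    show "0 < min a a'" using f(2) g(2) by simp
  qed
qed

section \<open>Integrals over the half-line and the fundamental lemma\<close>

abbreviation HL :: "real measure" where
  "HL \<equiv> lebesgue_on half_line"

lemma integrable_HL_iff:
  "integrable HL f \<longleftrightarrow> integrable lebesgue (\<lambda>x. if x > 0 then f x else (0::real))"
  using Lebesgue_Measure.integrable_restrict_UNIV[of half_line f] by simp

lemma integral_HL: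
  "integral\<^sup>L HL f = integral\<^sup>L lebesgue (\<lambda>x. if x > 0 then f x else (0::real))"
  using Lebesgue_Measure.integral_restrict_UNIV[of half_line f] by simp

lemma AE_HL_iff: "(AE x in HL. P x) \<longleftrightarrow> (AE x in lebesgue. x > 0 \<longrightarrow> P x)"
  by (subst AE_restrict_space_iff) auto

lemma borel_measurable_HL_iff:
  "f \<in> borel_measurable HL \<longleftrightarrow> (\<lambda>x. if x > 0 then f x else (0::real)) \<in> borel_measurable lebesgue"
  using borel_measurable_if[of half_line f] by simp

lemma borel_measurable_HL_AE:
  fixes f g :: "real \<Rightarrow> real"
  assumes "f \<in> borel_measurable HL" "AE x in HL. f x = g x"
  shows "g \<in> borel_measurable HL"
  using assms unfolding borel_measurable_HL_iff AE_HL_iff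
  by (elim borel_measurable_AE) auto

lemma continuous_on_measurable_HL:
  fixes f :: "real \<Rightarrow> real"
  assumes "continuous_on {0<..} f" shows "f \<in> borel_measurable HL"
  using assms by (simp add: continuous_imp_measurable_on_sets_lebesgue)

lemma borel_measurable_HL_indicator [measurable]:
  fixes A :: "real set"
  assumes "A \<in> sets borel" shows "(indicator A :: real \<Rightarrow> real) \<in> borel_measurable HL"
proof (rule measurable_restrict_space1)
  show "(indicator A :: real \<Rightarrow> real) \<in> borel_measurable lebesgue"
    using assms by (intro measurable_completion borel_measurable_indicator) simp
qed

lemma locally_integrable_indicator:
  assumes "locally_integrable h" "0 < a"
  shows "integrable HL (\<lambda>x. indicator {a..b} x * h x)"
proof -
  have "integrable (lebesgue_on {a..b}) h"
    using assms unfolding locally_integrable_def by (metis atLeastAtMost_iff compact_Icc greaterThan_iff order_less_le_trans subsetI)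
  then have "integrable lebesgue (\<lambda>x. if x \<in> {a..b} then h x else 0)"
    using Lebesgue_Measure.integrable_restrict_UNIV[of "{a..b}" h] by simp
  moreover have "(\<lambda>x. if x \<in> {a..b} then h x else 0) = (\<lambda>x. if x > 0 then indicator {a..b} x * h x else 0)"
    using assms(2) by (auto simp: indicator_def)
  ultimately show ?thesis
    by (simp add: integrable_HL_iff)
qed

lemma exhaust_half_line:
  assumes "(0::real) < x"
  shows "\<forall>\<^sub>F n in sequentially. inverse (real (Suc n)) < x \<and> x < real (Suc n)"
proof (rule eventually_conj)
  show "\<forall>\<^sub>F n in sequentially. inverse (real (Suc n)) < x"
    using LIMSEQ_inverse_real_of_nat assms by (rule order_tendstoD)
  obtain n where "x < real n" using reals_Archimedean2 by blast
  then show "\<forall>\<^sub>F n in sequentially. x < real (Suc n)"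
    by (intro eventually_sequentiallyI[of n]) auto
qed

lemma locally_integrable_measurable:
  assumes "locally_integrable h"
  shows "h \<in> borel_measurable HL"
proof (rule borel_measurable_LIMSEQ_real)
  show "(\<lambda>x. indicator {inverse (real (Suc n))..real (Suc n)} x * h x) \<in> borel_measurable HL" for n
    by (rule borel_measurable_integrable[OF locally_integrable_indicator[OF assms]]) simp
  fix x assume "x \<in> space HL"
  then have "x > 0" by simp
  from exhaust_half_line[OF this]
  show "(\<lambda>n. indicator {inverse (real (Suc n))..real (Suc n)} x * h x) \<longlonglongrightarrow> h x"
    by (intro tendsto_eventually) (erule eventually_mono, simp add: indicator_def less_imp_le)
qed

lemma integrable_HL_locally:
  fixes f :: "real \<Rightarrow> real"
  assumes "\<And>a b. 0 < a \<Longrightarrow> integrable HL (\<lambda>x. indicator {a..b} x * f x)"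
  shows "locally_integrable f"
  unfolding locally_integrable_def
proof (intro allI impI, elim conjE)
  fix K :: "real set" assume K: "compact K" "K \<subseteq> half_line"
  have K_leb [simp]: "K \<in> sets lebesgue" using K(1) by (simp add: compact_imp_closed borel_closed)
  show "integrable (lebesgue_on K) f"
  proof (cases "K = {}")
    case False
    obtain a where a: "a \<in> K" "\<And>x. x \<in> K \<Longrightarrow> a \<le> x"
      using compact_attains_inf[OF K(1) False] by blast
    obtain b where b: "b \<in> K" "\<And>x. x \<in> K \<Longrightarrow> x \<le> b"
      using compact_attains_sup[OF K(1) False] by blast
    have "0 < a" using a K by auto
    then have "integrable lebesgue (\<lambda>x. indicator K x *\<^sub>R (if x > 0 then indicator {a..b} x * f x else 0))"
      using assms[of a b] unfolding integrable_HL_iff by (intro integrable_mult_indicator K_leb)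
    moreover have "(\<lambda>x. indicator K x *\<^sub>R (if x > 0 then indicator {a..b} x * f x else 0))
        = (\<lambda>x. if x \<in> K then f x else 0)"
      using a b K by (auto simp: indicator_def fun_eq_iff)
    ultimately show ?thesis
      by (simp add: Lebesgue_Measure.integrable_restrict_UNIV)
  qed simp
qed

lemma locally_integrable_diff:
  assumes "locally_integrable f" "locally_integrable g"
  shows "locally_integrable (\<lambda>x. f x - g x)"
  using assms unfolding locally_integrable_def by simp

lemma bounded_on_Icc:
  fixes f :: "real \<Rightarrow> real"
  assumes "continuous_on UNIV f"
  obtains C where "C \<ge> 0" "\<And>x. x \<in> {a..b} \<Longrightarrow> \<bar>f x\<bar> \<le> C"
proof -
  have "compact (f ` {a..b})"
    by (rule compact_continuous_image[OF continuous_on_subset[OF assms]]) auto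
  then obtain C where "\<forall>y\<in>f ` {a..b}. norm y \<le> C" "0 < C"
    using compact_imp_bounded bounded_pos by metis
  then show ?thesis using that[of C] by auto
qed

lemma locally_integrable_times_test:
  assumes "locally_integrable f" "\<phi> \<in> test_functions"
  shows "integrable HL (\<lambda>x. f x * \<phi> x)"
proof -
  obtain a b where phi: "smooth \<phi>" "0 < a" "a < b" "\<And>x. x \<notin> {a..b} \<Longrightarrow> \<phi> x = 0"
    using test_functionsE[OF assms(2)] by blast
  obtain C where C: "C \<ge> 0" "\<And>x. x \<in> {a..b} \<Longrightarrow> \<bar>\<phi> x\<bar> \<le> C"
    using bounded_on_Icc[OF smooth_continuous_on[OF phi(1)]] by metis
  show ?thesis
  proof (rule Bochner_Integration.integrable_bound)
    show "integrable HL (\<lambda>x. C * (indicator {a..b} x * f x))"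
      using locally_integrable_indicator[OF assms(1) phi(2)] by simp
    show "(\<lambda>x. f x * \<phi> x) \<in> borel_measurable HL"
      by (intro borel_measurable_times locally_integrable_measurable[OF assms(1)]
          continuous_on_measurable_HL smooth_continuous_on[OF phi(1)])
    show "AE x in HL. norm (f x * \<phi> x) \<le> norm (C * (indicator {a..b} x * f x))"
    proof (rule AE_I2)
      fix x
      show "norm (f x * \<phi> x) \<le> norm (C * (indicator {a..b} x * f x))"
        using C phi(4)[of x]
        by (cases "x \<in> {a..b}") (auto simp: abs_mult mult.commute[of "\<bar>f x\<bar>"] intro!: mult_right_mono)
    qed
  qed
qed

text \<open>
  The positive and the negative part of \<open>k\<close> are densities of two finite measures that
  agree on all rays \<open>{c<..}\<close>. Rays generate the Borel sets, so the measures coincide,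
  and so do the densities.
\<close>

lemma AE_zero_if_tail_integrals_zero:
  fixes k :: "real \<Rightarrow> real"
  assumes k: "integrable lborel k"
    and zero: "\<And>c. (LINT x|lborel. indicator {c<..} x * k x) = 0"
  shows "AE x in lborel. k x = 0"
proof -
  have [measurable]: "k \<in> borel_measurable borel"
    using borel_measurable_integrable[OF k] by simp
  have fin: "(\<integral>\<^sup>+x. ennreal (k x) * indicator {c<..} x \<partial>lborel) < \<infinity>"
      "(\<integral>\<^sup>+x. ennreal (k x) * indicator {c<..} x \<partial>lborel)
        = (\<integral>\<^sup>+x. ennreal (- k x) * indicator {c<..} x \<partial>lborel)" for c
  proof -
    have int: "integrable lborel (\<lambda>x. indicator {c<..} x * k x)"
      using integrable_mult_indicator[OF _ k, of "{c<..}"] by simp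
    have eq: "(\<integral>\<^sup>+x. ennreal (k x) * indicator {c<..} x \<partial>lborel)
          = (\<integral>\<^sup>+x. ennreal (indicator {c<..} x * k x) \<partial>lborel)"
        "(\<integral>\<^sup>+x. ennreal (- k x) * indicator {c<..} x \<partial>lborel)
          = (\<integral>\<^sup>+x. ennreal (- (indicator {c<..} x * k x)) \<partial>lborel)"
      by (auto intro!: nn_integral_cong simp: indicator_def)
    from int have f: "(\<integral>\<^sup>+x. ennreal (indicator {c<..} x * k x) \<partial>lborel) \<noteq> \<infinity>"
        "(\<integral>\<^sup>+x. ennreal (- (indicator {c<..} x * k x)) \<partial>lborel) \<noteq> \<infinity>"
      by (auto simp: real_integrable_def)
    have "enn2real (\<integral>\<^sup>+x. ennreal (indicator {c<..} x * k x) \<partial>lborel)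
        = enn2real (\<integral>\<^sup>+x. ennreal (- (indicator {c<..} x * k x)) \<partial>lborel)"
      using real_lebesgue_integral_def[OF int] zero[of c] by simp
    from arg_cong[OF this, of ennreal]
    show "(\<integral>\<^sup>+x. ennreal (k x) * indicator {c<..} x \<partial>lborel)
        = (\<integral>\<^sup>+x. ennreal (- k x) * indicator {c<..} x \<partial>lborel)"
      unfolding eq using f by (metis ennreal_enn2real infinity_ennreal_def less_top)
    show "(\<integral>\<^sup>+x. ennreal (k x) * indicator {c<..} x \<partial>lborel) < \<infinity>"
      unfolding eq using f(1) by (simp add: less_top)
  qed
  have "density lborel (\<lambda>x. ennreal (k x)) = density lborel (\<lambda>x. ennreal (- k x))"
    by (rule measure_eqI_lessThan) (auto simp: emeasure_density fin(1)[unfolded infinity_ennreal_def] fin(2)[symmetric])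
  then have "AE x in lborel. ennreal (k x) = ennreal (- k x)"
    by (subst (asm) sigma_finite_measure.density_unique_iff[OF sigma_finite_lborel]) auto
  then show ?thesis
  proof eventually_elim
    case (elim x)
    then show ?case
      by (cases "k x \<ge> 0") (auto simp: ennreal_neg dest: sym)
  qed
qed

lemma integral_interval_zero:
  assumes h: "locally_integrable h" "0 < a"
    and zero: "\<And>\<phi>. \<phi> \<in> test_functions \<Longrightarrow> (LINT x|HL. h x * \<phi> x) = 0"
  shows "(LINT x|HL. h x * indicator {a<..<b} x) = 0"
proof -
  have "(\<lambda>j. LINT x|HL. h x * bump a b (real (Suc j)) x) \<longlonglongrightarrow> (LINT x|HL. h x * indicator {a<..<b} x)"
  proof (rule integral_dominated_convergence)
    show "integrable HL (\<lambda>x. \<bar>indicator {a..b} x * h x\<bar>)"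
      using locally_integrable_indicator[OF h] by (rule integrable_abs)
    show "(\<lambda>x. h x * indicator {a<..<b} x) \<in> borel_measurable HL"
      by (intro borel_measurable_times locally_integrable_measurable[OF h(1)] borel_measurable_HL_indicator) simp
    show "(\<lambda>x. h x * bump a b (real (Suc j)) x) \<in> borel_measurable HL" for j
      by (rule borel_measurable_integrable, rule locally_integrable_times_test[OF h(1)],
          rule test_function_bump[OF h(2)]) simp
    show "AE x in HL. (\<lambda>j. h x * bump a b (real (Suc j)) x) \<longlonglongrightarrow> h x * indicator {a<..<b} x"
      by (intro AE_I2 tendsto_intros bump_tendsto_indicator)
    show "AE x in HL. norm (h x * bump a b (real (Suc j)) x) \<le> \<bar>indicator {a..b} x * h x\<bar>" for j
    proof (rule AE_I2)
      fix x
      show "norm (h x * bump a b (real (Suc j)) x) \<le> \<bar>indicator {a..b} x * h x\<bar>"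
      proof (cases "x \<in> {a..b}")
        case True
        have "\<bar>h x\<bar> * bump a b (real (Suc j)) x \<le> \<bar>h x\<bar>"
          by (intro mult_left_le bump_bounds) simp
        then show ?thesis using True bump_bounds(1)[of a b "real (Suc j)" x]
          by (simp add: abs_mult)
      next
        case False
        then have "bump a b (real (Suc j)) x = 0"
          by (auto simp: bump_def flat_exp_def zero_less_mult_iff)
        then show ?thesis by simp
      qed
    qed
  qed
  moreover have "(LINT x|HL. h x * bump a b (real (Suc j)) x) = 0" for j
    by (rule zero, rule test_function_bump[OF h(2)]) simp
  ultimately show ?thesis
    by (simp add: LIMSEQ_const_iff)
qed

text \<open>
  Testing against bumps that converge to the indicator function of an interval shows that the
  integral of \<open>h\<close> over each compact interval in the half-line vanishes. The passage
  from intervals to points is made with a Borel representative of \<open>h\<close> on each of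
  countably many intervals that exhaust the half-line.
\<close>

lemma fundamental_lemma:
  assumes h: "locally_integrable h"
    and zero: "\<And>\<phi>. \<phi> \<in> test_functions \<Longrightarrow> (LINT x|HL. h x * \<phi> x) = 0"
  shows "AE x in HL. h x = 0"
proof -
  have loc: "AE x in lebesgue. a < x \<and> x < b \<longrightarrow> h x = 0" if "0 < a" for a b
  proof -
    define k0 where "k0 = (\<lambda>x. if a < x \<and> x < b then h x else 0)"
    have k0_eq: "k0 = (\<lambda>x. indicator {a<..<b} x *\<^sub>R (if x > 0 then indicator {a..b} x * h x else 0))"
      using that by (auto simp: k0_def fun_eq_iff indicator_def)
    have k0: "integrable lebesgue k0"
      unfolding k0_eq by (rule integrable_mult_indicator,
          simp, rule locally_integrable_indicator[OF h that, of b, unfolded integrable_HL_iff])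
    obtain k where k: "k \<in> borel_measurable lborel" "AE x in lborel. k0 x = k x"
      using completion_ex_borel_measurable_real[OF borel_measurable_integrable[OF k0]] by blast
    have km [measurable]: "k \<in> borel_measurable borel" using k(1) by simp
    have AEk: "AE x in lebesgue. k0 x = k x" using k(2) by (rule AE_completion)
    have kmL: "k \<in> borel_measurable lebesgue"
      using k(1) by (rule measurable_completion)
    have "integrable lebesgue k"
      by (rule integrable_cong_AE_imp[OF k0 kmL]) (use AEk in \<open>auto simp: eq_commute\<close>)
    then have "integrable lborel k"
      using k(1) integrable_completion by blast
    moreover have "(LINT x|lborel. indicator {c<..} x * k x) = 0" for c
    proof -
      have "(LINT x|lborel. indicator {c<..} x * k x) = (LINT x|lebesgue. indicator {c<..} x * k x)"
        by (rule integral_completion[symmetric]) measurable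
      also have "\<dots> = (LINT x|lebesgue. indicator {c<..} x * k0 x)"
      proof (rule integral_cong_AE)
        show "(\<lambda>x. indicator {c<..} x * k x) \<in> borel_measurable lebesgue"
          by (rule measurable_completion) measurable
        show "(\<lambda>x. indicator {c<..} x * k0 x) \<in> borel_measurable lebesgue"
          by (intro borel_measurable_times borel_measurable_integrable[OF k0]
              measurable_completion[of "indicator {c<..} :: real \<Rightarrow> real" lborel]) measurable
        show "AE x in lebesgue. indicator {c<..} x * k x = indicator {c<..} x * k0 x"
          using AEk by eventually_elim simp
      qed
      also have "\<dots> = (LINT x|HL. h x * indicator {max a c<..<b} x)"
        unfolding integral_HL
        by (rule Bochner_Integration.integral_cong) (use that in \<open>auto simp: k0_def indicator_def\<close>)
      also have "\<dots> = 0"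
        using that by (intro integral_interval_zero h zero) auto
      finally show ?thesis .
    qed
    ultimately have "AE x in lborel. k x = 0"
      by (rule AE_zero_if_tail_integrals_zero)
    then have "AE x in lebesgue. k x = 0" by (rule AE_completion)
    with AEk show ?thesis by eventually_elim (auto simp: k0_def split: if_splits)
  qed
  have "AE x in lebesgue. \<forall>n. inverse (real (Suc n)) < x \<and> x < real (Suc n) \<longrightarrow> h x = 0"
    unfolding AE_all_countable by (intro allI loc) simp
  then show ?thesis
    unfolding AE_HL_iff
  proof eventually_elim
    case (elim x)
    show ?case
    proof
      assume "0 < x"
      from exhaust_half_line[OF this] obtain n where "inverse (real (Suc n)) < x \<and> x < real (Suc n)"
        by (auto dest: eventually_happens)
      then show "h x = 0" using elim by blast
    qed
  qed
qed

section \<open>Exponentially decaying functions\<close>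

text \<open>
  Test functions and Laguerre functions have in common that they decay exponentially on the
  half-line. This common class is closed under products, consists of square-integrable functions,
  and makes boundary terms at infinity vanish.
\<close>

definition decays :: "(real \<Rightarrow> real) \<Rightarrow> bool" where
  "decays f \<longleftrightarrow> continuous_on UNIV f \<and>
     (\<exists>C \<gamma>. 0 < \<gamma> \<and> 0 \<le> C \<and> (\<forall>x\<ge>0. \<bar>f x\<bar> \<le> C * exp (- (\<gamma> * x))))"

lemma decaysE:
  assumes "decays f"
  obtains C \<gamma> where "0 < \<gamma>" "0 \<le> C" "\<And>x. x \<ge> 0 \<Longrightarrow> \<bar>f x\<bar> \<le> C * exp (- (\<gamma> * x))"
  using assms unfolding decays_def by blast

lemma decays_continuous: "decays f \<Longrightarrow> continuous_on A f"
  unfolding decays_def using continuous_on_subset by blast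

lemma decays_mult:
  assumes "decays f" "decays g" shows "decays (\<lambda>x. f x * g x)"
proof -
  obtain C \<gamma> where f: "0 < \<gamma>" "0 \<le> C" "\<And>x. x \<ge> 0 \<Longrightarrow> \<bar>f x\<bar> \<le> C * exp (- (\<gamma> * x))"
    using decaysE[OF assms(1)] by metis
  obtain D \<delta> where g: "0 < \<delta>" "0 \<le> D" "\<And>x. x \<ge> 0 \<Longrightarrow> \<bar>g x\<bar> \<le> D * exp (- (\<delta> * x))"
    using decaysE[OF assms(2)] by metis
  have "\<bar>f x * g x\<bar> \<le> (C * D) * exp (- ((\<gamma> + \<delta>) * x))" if "x \<ge> 0" for x
  proof -
    have "\<bar>f x * g x\<bar> \<le> (C * exp (- (\<gamma> * x))) * (D * exp (- (\<delta> * x)))"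
      unfolding abs_mult using f g that by (intro mult_mono) auto
    also have "\<dots> = (C * D) * exp (- ((\<gamma> + \<delta>) * x))"
      by (simp add: exp_add[symmetric] algebra_simps mult_exp_exp)
    finally show ?thesis .
  qed
  moreover have "0 < \<gamma> + \<delta>" "0 \<le> C * D" using f g by auto
  ultimately show ?thesis
    unfolding decays_def using decays_continuous assms by (blast intro: continuous_on_mult)
qed

lemma decays_add:
  assumes "decays f" "decays g" shows "decays (\<lambda>x. f x + g x)"
proof -
  obtain C \<gamma> where f: "0 < \<gamma>" "0 \<le> C" "\<And>x. x \<ge> 0 \<Longrightarrow> \<bar>f x\<bar> \<le> C * exp (- (\<gamma> * x))"
    using decaysE[OF assms(1)] by metis
  obtain D \<delta> where g: "0 < \<delta>" "0 \<le> D" "\<And>x. x \<ge> 0 \<Longrightarrow> \<bar>g x\<bar> \<le> D * exp (- (\<delta> * x))"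
    using decaysE[OF assms(2)] by metis
  have "\<bar>f x + g x\<bar> \<le> (C + D) * exp (- (min \<gamma> \<delta> * x))" if "x \<ge> 0" for x
  proof -
    have "C * exp (- (\<gamma> * x)) \<le> C * exp (- (min \<gamma> \<delta> * x))"
        "D * exp (- (\<delta> * x)) \<le> D * exp (- (min \<gamma> \<delta> * x))"
      using f(2) g(2) that by (auto intro!: mult_left_mono mult_right_mono)
    then show ?thesis using f(3)[OF that] g(3)[OF that] by (simp add: distrib_right)
  qed
  moreover have "0 < min \<gamma> \<delta>" "0 \<le> C + D" using f g by auto
  ultimately show ?thesis
    unfolding decays_def using decays_continuous assms by (blast intro: continuous_on_add)
qed

lemma decays_exp: "0 < \<gamma> \<Longrightarrow> decays (\<lambda>x. exp (- (\<gamma> * x)))"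
  unfolding decays_def
  by (intro conjI continuous_intros exI[of _ 1] exI[of _ \<gamma>]) auto

text \<open>
  The constant \<open>C * exp b\<close> absorbs the factor \<open>exp (- x) \<ge> exp (-
  b)\<close> on the support.
\<close>

lemma decays_compact:
  assumes "continuous_on UNIV f" "\<And>x. x > b \<Longrightarrow> f x = 0"
  shows "decays f"
proof -
  obtain C where C: "C \<ge> 0" "\<And>x. x \<in> {0..b} \<Longrightarrow> \<bar>f x\<bar> \<le> C"
    using bounded_on_Icc[OF assms(1)] by metis
  have "\<bar>f x\<bar> \<le> (C * exp b) * exp (- (1 * x))" if "x \<ge> 0" for x
  proof (cases "x \<le> b")
    case True
    then have "\<bar>f x\<bar> \<le> C * 1" using C that by simp
    also have "\<dots> \<le> C * exp (b - x)" using C True by (intro mult_left_mono) auto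
    finally show ?thesis by (simp add: exp_diff exp_minus divide_inverse)
  next
    case False
    then show ?thesis using assms(2) C(1) by simp
  qed
  moreover have "0 \<le> C * exp b" using C by simp
  ultimately show ?thesis
    unfolding decays_def using assms(1) zero_less_one by blast
qed

lemma decays_test:
  assumes "\<phi> \<in> test_functions" shows "decays \<phi>"
proof -
  obtain a b where "smooth \<phi>" "\<And>x. x \<notin> {a..b} \<Longrightarrow> \<phi> x = 0"
    using test_functionsE[OF assms] by blast
  then show ?thesis by (intro decays_compact[of _ b] smooth_continuous_on) auto
qed

lemma decays_measurable: "decays f \<Longrightarrow> f \<in> borel_measurable borel"
  using decays_continuous borel_measurable_continuous_onI by blast

lemma decays_measurable_HL: "decays f \<Longrightarrow> f \<in> borel_measurable HL"
  using decays_continuous continuous_on_measurable_HL by blast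

lemma integrable_exp_HL:
  assumes "0 < \<gamma>" shows "integrable HL (\<lambda>x. exp (- (\<gamma> * x)))"
proof -
  have "(\<lambda>x. exp (- \<gamma> * x)) integrable_on {0..}"
    using has_integral_exp_minus_to_infinity[OF assms, of 0] by (auto simp: integrable_on_def)
  then have "(\<lambda>x. exp (- \<gamma> * x)) absolutely_integrable_on {0..}"
    by (intro nonnegative_absolutely_integrable_1) auto
  then have "integrable lebesgue (\<lambda>x. indicator {0<..} x *\<^sub>R (indicator {0..} x *\<^sub>R exp (- \<gamma> * x)))"
    unfolding set_integrable_def by (rule integrable_mult_indicator[rotated]) simp
  moreover have "(\<lambda>x. indicator {0<..} x *\<^sub>R (indicator {0..} x *\<^sub>R exp (- \<gamma> * x)))
      = (\<lambda>x. if x > 0 then exp (- (\<gamma> * x)) else 0)"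
    by (auto simp: indicator_def fun_eq_iff)
  ultimately show ?thesis unfolding integrable_HL_iff by argo
qed

lemma decays_integrable:
  assumes "decays f" shows "integrable HL f"
proof -
  obtain C \<gamma> where f: "0 < \<gamma>" "0 \<le> C" "\<And>x. x \<ge> 0 \<Longrightarrow> \<bar>f x\<bar> \<le> C * exp (- (\<gamma> * x))"
    using decaysE[OF assms] by metis
  show ?thesis
  proof (rule Bochner_Integration.integrable_bound)
    show "integrable HL (\<lambda>x. C * exp (- (\<gamma> * x)))" using integrable_exp_HL[OF f(1)] by simp
    show "f \<in> borel_measurable HL" using assms by (rule decays_measurable_HL)
    show "AE x in HL. norm (f x) \<le> norm (C * exp (- (\<gamma> * x)))"
      using f by (intro AE_I2) (auto simp: abs_mult)
  qed
qed

lemma decays_tendsto_0: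
  assumes "decays f" shows "(f \<longlongrightarrow> 0) at_top"
proof -
  obtain C \<gamma> where f: "0 < \<gamma>" "0 \<le> C" "\<And>x. x \<ge> 0 \<Longrightarrow> \<bar>f x\<bar> \<le> C * exp (- (\<gamma> * x))"
    using decaysE[OF assms] by metis
  have lim: "LIM x at_top. - (\<gamma> * x) :> at_bot"
    using f(1) by (simp add: filterlim_uminus_at_bot filterlim_tendsto_pos_mult_at_top[OF tendsto_const] filterlim_ident)
  have "((\<lambda>x. C * exp (- (\<gamma> * x))) \<longlongrightarrow> C * 0) at_top"
    by (intro tendsto_intros filterlim_compose[OF exp_at_bot lim])
  then show ?thesis
    by (intro Lim_null_comparison[of f "\<lambda>x. C * exp (- (\<gamma> * x))"])
      (use f(3) in \<open>auto intro!: eventually_at_top_linorderI[of 0]\<close>)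
qed

section \<open>Square-integrable functions and their primitives\<close>

lemma L2I: "f \<in> borel_measurable HL \<Longrightarrow> integrable HL (\<lambda>x. (f x)\<^sup>2) \<Longrightarrow> f \<in> L2"
  and L2_measurable: "f \<in> L2 \<Longrightarrow> f \<in> borel_measurable HL"
  and L2_square: "f \<in> L2 \<Longrightarrow> integrable HL (\<lambda>x. (f x)\<^sup>2)"
  unfolding L2_def by auto

lemma L2_decays: "decays f \<Longrightarrow> f \<in> L2"
  by (intro L2I decays_measurable_HL) (auto simp: power2_eq_square intro: decays_integrable decays_mult)

lemma L2_mult_integrable:
  assumes "f \<in> L2" "g \<in> L2" shows "integrable HL (\<lambda>x. f x * g x)"
proof (rule Bochner_Integration.integrable_bound)
  show "integrable HL (\<lambda>x. (f x)\<^sup>2 + (g x)\<^sup>2)"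
    using assms by (intro Bochner_Integration.integrable_add L2_square)
  show "(\<lambda>x. f x * g x) \<in> borel_measurable HL"
    using assms by (intro borel_measurable_times L2_measurable)
  have "\<bar>s * t\<bar> \<le> s\<^sup>2 + t\<^sup>2" for s t :: real
  proof -
    have "0 \<le> \<bar>s\<bar> * \<bar>t\<bar>" by simp
    then show ?thesis
      using sum_squares_bound[of "\<bar>s\<bar>" "\<bar>t\<bar>"] unfolding abs_mult power2_abs by linarith
  qed
  then show "AE x in HL. norm (f x * g x) \<le> norm ((f x)\<^sup>2 + (g x)\<^sup>2)"
    by (intro AE_I2) simp
qed

lemma L2_AE:
  assumes "f \<in> L2" "AE x in HL. f x = g x" shows "g \<in> L2"
proof (rule L2I)
  show g: "g \<in> borel_measurable HL"
    using borel_measurable_HL_AE L2_measurable assms by blast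
  show "integrable HL (\<lambda>x. (g x)\<^sup>2)"
    by (rule integrable_cong_AE_imp[OF L2_square[OF assms(1)]])
      (use g assms(2) in \<open>auto intro!: borel_measurable_power elim: eventually_mono\<close>)
qed

lemma L2_diff:
  assumes "f \<in> L2" "g \<in> L2" shows "(\<lambda>x. f x - g x) \<in> L2"
proof (rule L2I)
  show "(\<lambda>x. f x - g x) \<in> borel_measurable HL"
    using assms by (intro borel_measurable_diff L2_measurable)
  have "integrable HL (\<lambda>x. (f x)\<^sup>2 + (g x)\<^sup>2 - 2 * (f x * g x))"
    using assms by (intro Bochner_Integration.integrable_add Bochner_Integration.integrable_diff
        integrable_mult_right L2_square L2_mult_integrable)
  then show "integrable HL (\<lambda>x. (f x - g x)\<^sup>2)"
    by (simp add: power2_diff mult.assoc)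
qed

lemma L2_indicator: "(indicator {..b} :: real \<Rightarrow> real) \<in> L2"
proof (rule L2I)
  show "(indicator {..b} :: real \<Rightarrow> real) \<in> borel_measurable HL" by (rule borel_measurable_HL_indicator) simp
  have "integrable lebesgue (indicator {0<..b} :: real \<Rightarrow> real)"
    using emeasure_bounded_finite[of "{0<..b}"] by (intro integrable_real_indicator) (auto simp: bounded_subset)
  moreover have "(indicator {0<..b} :: real \<Rightarrow> real) = (\<lambda>x. if x > 0 then (indicator {..b} x)\<^sup>2 else 0)"
    by (auto simp: indicator_def fun_eq_iff)
  ultimately show "integrable HL (\<lambda>x. (indicator {..b} x :: real)\<^sup>2)"
    by (simp add: integrable_HL_iff)
qed

lemma L2_integrable_initial: "v \<in> L2 \<Longrightarrow> integrable HL (\<lambda>x. indicator {..b} x * v x)"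
  by (rule L2_mult_integrable[OF L2_indicator])

lemma L2_locally_integrable:
  assumes "v \<in> L2" shows "locally_integrable v"
proof (rule integrable_HL_locally)
  fix a b :: real
  have "(\<lambda>x. indicator {a..b} x * v x) = (\<lambda>x. indicator {a..} x *\<^sub>R (indicator {..b} x * v x))"
    by (auto simp: indicator_def fun_eq_iff)
  moreover have "integrable HL (\<lambda>x. indicator {a..} x *\<^sub>R (indicator {..b} x * v x))"
  proof (rule Bochner_Integration.integrable_bound[OF L2_integrable_initial[OF assms, of b]])
    show "(\<lambda>x. indicator {a..} x *\<^sub>R (indicator {..b} x * v x)) \<in> borel_measurable HL"
      using borel_measurable_HL_indicator[of "{a..}"] L2_integrable_initial[OF assms, of b]
      by (intro borel_measurable_scaleR) auto
  qed (auto simp: indicator_def)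
  ultimately show "integrable HL (\<lambda>x. indicator {a..b} x * v x)" by simp
qed

lemma continuous_locally_integrable:
  fixes f :: "real \<Rightarrow> real"
  assumes "continuous_on {0..} f" shows "locally_integrable f"
proof (rule integrable_HL_locally)
  fix a b :: real assume a: "0 < a"
  have "f absolutely_integrable_on {a..b}"
    by (rule absolutely_integrable_continuous_real, rule continuous_on_subset[OF assms]) (use a in auto)
  moreover have "(\<lambda>x. indicator {a..b} x *\<^sub>R f x) = (\<lambda>x. if x > 0 then indicator {a..b} x * f x else 0)"
    using a by (auto simp: indicator_def fun_eq_iff)
  ultimately show "integrable HL (\<lambda>x. indicator {a..b} x * f x)"
    unfolding integrable_HL_iff set_integrable_def by argo
qed

text \<open>
  An antiderivative in the weak sense, continuous up to the endpoint, where it vanishes. For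
  \<open>x \<le> 0\<close> the integral is over the empty set, so its value there is 0.
\<close>

definition primitive :: "(real \<Rightarrow> real) \<Rightarrow> real \<Rightarrow> real" where
  "primitive v x = (LINT t|HL. indicator {..x} t * v t)"

lemma primitive_0 [simp]: "primitive v 0 = 0"
proof -
  have "primitive v 0 = (LINT t|HL. 0)"
    unfolding primitive_def by (rule Bochner_Integration.integral_cong) auto
  then show ?thesis by simp
qed

lemma primitive_diff:
  assumes "v \<in> L2" "w \<in> L2"
  shows "primitive (\<lambda>x. v x - w x) x = primitive v x - primitive w x"
  unfolding primitive_def right_diff_distrib
  by (intro Bochner_Integration.integral_diff L2_integrable_initial assms)

text \<open>
  The Lebesgue integral equals a Henstock-Kurzweil integral, for which continuity in the upper
  limit is known.
\<close>

lemma continuous_on_primitive: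
  assumes "v \<in> L2" shows "continuous_on {0..} (primitive v)"
proof -
  define v0 where "v0 = (\<lambda>x. if x > 0 then v x else 0)"
  have v0: "integrable (lebesgue_on {0..x}) v0" 
       "primitive v x = integral\<^sup>L (lebesgue_on {0..x}) v0" for x
  proof -
    have eq: "(\<lambda>t. if t \<in> {0..x} then v0 t else 0) = (\<lambda>t. if t > 0 then indicator {..x} t * v t else 0)"
      by (auto simp: v0_def indicator_def fun_eq_iff)
    show "integrable (lebesgue_on {0..x}) v0"
      using L2_integrable_initial[OF assms, of x]
        Lebesgue_Measure.integrable_restrict_UNIV[of "{0..x}" v0]
      unfolding integrable_HL_iff eq by simp
    show "primitive v x = integral\<^sup>L (lebesgue_on {0..x}) v0"
      using Lebesgue_Measure.integral_restrict_UNIV[of "{0..x}" v0]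
      unfolding primitive_def integral_HL eq by simp
  qed
  have eq: "primitive v x = integral {0..x} v0" for x
    using has_integral_integral_lebesgue_on[OF v0(1), of x] v0(2)[of x]
    by (simp add: integral_unique)
  have cont: "continuous_on {0..b} (primitive v)" for b
  proof -
    have "v0 integrable_on {0..b}"
      by (rule integrable_on_lebesgue_on[OF v0(1)]) simp
    from indefinite_integral_continuous_1[OF this] show ?thesis
      by (simp add: eq cong: continuous_on_cong)
  qed
  show ?thesis
    unfolding continuous_on_eq_continuous_within
  proof
    fix x :: real assume x: "x \<in> {0..}"
    have "at x within {0..} = at x within {0..x + 1}"
      by (rule at_within_nhd[of _ "{..<x + 1}"]) (use x in auto)
    moreover have "continuous (at x within {0..x + 1}) (primitive v)"
      using cont[of "x + 1"] x by (auto simp: continuous_on_eq_continuous_within)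
    ultimately show "continuous (at x within {0..}) (primitive v)"
      by (simp add: continuous_within)
  qed
qed

lemma decays_lborel_integrable:
  assumes "decays f" "0 \<le> t" shows "integrable lborel (\<lambda>x. indicator {t<..} x * f x)"
proof -
  have [measurable]: "f \<in> borel_measurable borel" using assms by (intro decays_measurable)
  have "integrable lebesgue (\<lambda>x. if x > 0 then f x else 0)"
    using decays_integrable[OF assms(1)] by (simp add: integrable_HL_iff)
  then have "integrable lborel (\<lambda>x. if x > 0 then f x else 0)"
    by (subst (asm) integrable_completion) auto
  then have "integrable lborel (\<lambda>x. indicator {t<..} x *\<^sub>R (if x > 0 then f x else 0))"
    by (intro integrable_mult_indicator) auto
  moreover have "(\<lambda>x. indicator {t<..} x *\<^sub>R (if x > 0 then f x else 0)) = (\<lambda>x. indicator {t<..} x * f x)"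
    using assms(2) by (auto simp: indicator_def fun_eq_iff)
  ultimately show ?thesis by simp
qed

lemma decays_FTC:
  assumes F: "decays F" "decays f" "\<And>x. (F has_real_derivative f x) (at x)" and t: "0 \<le> t"
  shows "(LINT x|lborel. indicator {t<..} x * f x) = - F t"
proof -
  have cont: "isCont f x" "isCont F x" for x
    using decays_continuous[OF F(2), of UNIV] decays_continuous[OF F(1), of UNIV]
    by (simp_all add: continuous_on_eq_continuous_at)
  have "(LBINT x=ereal t..\<infinity>. f x) = 0 - F t"
  proof (rule interval_integral_FTC_integrable)
    show "set_integrable lborel (einterval (ereal t) \<infinity>) f"
      using decays_lborel_integrable[OF F(2) t] by (simp add: set_integrable_def)
    show "((F \<circ> real_of_ereal) \<longlongrightarrow> F t) (at_right (ereal t))"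
      unfolding ereal_tendsto_simps
      using cont(2)[of t] by (simp add: isCont_def filterlim_at_split)
    show "((F \<circ> real_of_ereal) \<longlongrightarrow> 0) (at_left \<infinity>)"
      unfolding ereal_tendsto_simps by (rule decays_tendsto_0[OF F(1)])
  qed (use F(3) cont in \<open>auto simp: has_real_derivative_iff_has_vector_derivative\<close>)
  then show ?thesis
    by (simp add: interval_integral_to_infinity_eq set_lebesgue_integral_def)
qed

lemma integral_HL_lborel:
  fixes f :: "real \<Rightarrow> real"
  assumes "f \<in> borel_measurable borel"
  shows "integral\<^sup>L HL f = (LINT x|lborel. indicator {0<..} x * f x)"
proof -
  have "integral\<^sup>L HL f = (LINT x|lebesgue. indicator {0<..} x * f x)"
    unfolding integral_HL by (rule Bochner_Integration.integral_cong) auto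
  also have "\<dots> = (LINT x|lborel. indicator {0<..} x * f x)"
    using assms by (intro integral_completion) measurable
  finally show ?thesis .
qed

lemma decays_integral_deriv:
  assumes "decays F" "decays f" "\<And>x. (F has_real_derivative f x) (at x)"
  shows "(LINT x|HL. f x) = - F 0"
  using decays_FTC[OF assms, of 0] integral_HL_lborel[OF decays_measurable[OF assms(2)]] by simp

section \<open>Integration by parts\<close>

lemma integrable_lborel_product:
  fixes p q :: "real \<Rightarrow> real"
  assumes p: "integrable lborel p" and q: "integrable lborel q"
  shows "integrable (lborel \<Otimes>\<^sub>M lborel) (\<lambda>(t, x). p t * q x)"
proof (rule lborel_pair.Fubini_integrable)
  have [measurable]: "p \<in> borel_measurable borel" "q \<in> borel_measurable borel"
    using borel_measurable_integrable[OF p] borel_measurable_integrable[OF q] by simp_all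
  show "(\<lambda>(t, x). p t * q x) \<in> borel_measurable (lborel \<Otimes>\<^sub>M lborel)"
    by measurable
  show "integrable lborel (\<lambda>t. LINT x|lborel. norm (case (t, x) of (t, x) \<Rightarrow> p t * q x))"
    using p q by (simp add: abs_mult)
  show "AE t in lborel. integrable lborel (\<lambda>x. case (t, x) of (t, x) \<Rightarrow> p t * q x)"
    using q by simp
qed

text \<open>
  Fubini is applied to the product of two Borel measures, whereas functions in \<open>L2\<close>
  are only Lebesgue measurable. Passing to a Borel representative bridges the gap.
\<close>

lemma borel_representative:
  assumes "v \<in> borel_measurable HL"
  obtains g :: "real \<Rightarrow> real" where "g \<in> borel_measurable borel" "\<And>x. x \<le> 0 \<Longrightarrow> g x = 0"
    "AE x in lebesgue. (if x > 0 then v x else 0) = g x"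
proof -
  obtain g where g: "g \<in> borel_measurable lborel" "AE x in lborel. (if x > 0 then v x else 0) = g x"
    using completion_ex_borel_measurable_real[of "\<lambda>x. if x > 0 then v x else 0" lborel] assms
    unfolding borel_measurable_HL_iff by blast
  have [measurable]: "g \<in> borel_measurable borel" using g(1) by simp
  show ?thesis
  proof (rule that[of "\<lambda>x. if x > 0 then g x else 0"])
    show "AE x in lebesgue. (if x > 0 then v x else 0) = (if x > 0 then g x else 0)"
      using AE_completion[OF g(2)] by eventually_elim auto
    show "(\<lambda>x. if x > 0 then g x else 0) \<in> borel_measurable borel" by measurable
  qed simp
qed

lemma integral_representative:
  fixes g h :: "real \<Rightarrow> real"
  assumes v: "v \<in> borel_measurable HL"
    and g: "g \<in> borel_measurable borel" "AE x in lebesgue. (if x > 0 then v x else 0) = g x"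
    and h: "h \<in> borel_measurable borel"
  shows "(LINT x|HL. h x * v x) = (LINT x|lborel. h x * g x)"
    and "integrable HL (\<lambda>x. h x * v x) \<longleftrightarrow> integrable lborel (\<lambda>x. h x * g x)"
proof -
  have eq: "(\<lambda>x. if x > 0 then h x * v x else 0) = (\<lambda>x. h x * (if x > 0 then v x else 0))"
    by auto
  have hg: "(\<lambda>x. h x * g x) \<in> borel_measurable lborel"
    using g(1) h by measurable
  have m1: "(\<lambda>x. h x * (if x > 0 then v x else 0)) \<in> borel_measurable lebesgue"
    using v h unfolding borel_measurable_HL_iff
    by (intro borel_measurable_times) (auto intro: measurable_completion)
  have m2: "(\<lambda>x. h x * g x) \<in> borel_measurable lebesgue"
    by (rule measurable_completion[OF hg])
  have ae: "AE x in lebesgue. h x * (if x > 0 then v x else 0) = h x * g x"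
    using g(2) by eventually_elim simp
  show "(LINT x|HL. h x * v x) = (LINT x|lborel. h x * g x)"
    unfolding integral_HL eq integral_cong_AE[OF m1 m2 ae] by (rule integral_completion[OF hg])
  show "integrable HL (\<lambda>x. h x * v x) \<longleftrightarrow> integrable lborel (\<lambda>x. h x * g x)"
    unfolding integrable_HL_iff eq integrable_cong_AE[OF m1 m2 ae] by (rule integrable_completion[OF hg])
qed

text \<open>
  The function \<open>primitive v\<close> is in general differentiable only almost everywhere, so
  the product rule is not available. Instead, write \<open>\<psi> t\<close> as minus the integral
  of \<open>\<psi>'\<close> over \<open>{t<..}\<close> and exchange the order of integration in
  the double integral of \<open>v t * \<psi>' x\<close> over \<open>0 < t < x\<close>. There is no
  boundary term at 0 because the primitive vanishes there.
\<close>

lemma integration_by_parts: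
  assumes v: "v \<in> L2" and psi: "decays \<psi>" "decays \<psi>'" "\<And>x. (\<psi> has_real_derivative \<psi>' x) (at x)"
  shows "(LINT x|HL. primitive v x * \<psi>' x) = - (LINT x|HL. v x * \<psi> x)"
proof -
  obtain g where g: "g \<in> borel_measurable borel" "\<And>x. x \<le> 0 \<Longrightarrow> g x = 0"
      "AE x in lebesgue. (if x > 0 then v x else 0) = g x"
    using borel_representative[OF L2_measurable[OF v]] by metis
  note [measurable] = g(1) decays_measurable[OF psi(1)] decays_measurable[OF psi(2)]
  note repr = integral_representative[OF L2_measurable[OF v] g(1,3)]
  obtain C \<gamma> where C: "0 < \<gamma>" "0 \<le> C" "\<And>x. x \<ge> 0 \<Longrightarrow> \<bar>\<psi>' x\<bar> \<le> C * exp (- (\<gamma> * x))"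
    using decaysE[OF psi(2)] by metis
  \<comment> \<open>Half of the decay of \<open>\<psi>'\<close> is spent on the variable \<open>t < x\<close>, to make \<open>g\<close> integrable, which
    bounds the integrand by a product of functions of one variable.\<close>
  define \<delta> where "\<delta> = \<gamma> / 2"
  have delta: "\<delta> > 0" using C by (simp add: \<delta>_def)
  let ?e = "\<lambda>x. exp (- (\<delta> * x))"
  let ?f = "\<lambda>t x. if 0 < t \<and> t < x then g t * \<psi>' x else 0"
  have int_g: "integrable lborel (\<lambda>t. ?e t * g t)"
    by (subst repr(2)[symmetric])
      (auto intro!: L2_mult_integrable L2_decays decays_exp delta v)
  have int_e: "integrable lborel (\<lambda>x. indicator {0<..} x * ?e x)"
    by (intro decays_lborel_integrable decays_exp delta) simp
  have prod: "integrable (lborel \<Otimes>\<^sub>M lborel) (\<lambda>(t, x). (?e t * g t) * (C * (indicator {0<..} x * ?e x)))"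
    by (intro integrable_lborel_product int_g integrable_mult_right int_e)
  have int: "integrable (lborel \<Otimes>\<^sub>M lborel) (case_prod ?f)"
  proof (rule Bochner_Integration.integrable_bound[OF prod])
    show "case_prod ?f \<in> borel_measurable (lborel \<Otimes>\<^sub>M lborel)" by measurable
    have "\<bar>?f t x\<bar> \<le> \<bar>(?e t * g t) * (C * (indicator {0<..} x * ?e x))\<bar>" for t x
    proof (cases "0 < t \<and> t < x")
      case True
      have "\<bar>\<psi>' x\<bar> \<le> C * exp (- (\<gamma> * x))" using C(3)[of x] True by simp
      also have "\<dots> \<le> C * (?e t * ?e x)"
      proof (rule mult_left_mono)
        have "\<delta> * t + \<delta> * x \<le> \<gamma> * x"
          using mult_left_mono[of t x \<gamma>] True C(1) by (simp add: \<delta>_def field_simps)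
        then show "exp (- (\<gamma> * x)) \<le> ?e t * ?e x" by (simp add: mult_exp_exp)
      qed (use C in auto)
      finally have "\<bar>g t\<bar> * \<bar>\<psi>' x\<bar> \<le> \<bar>g t\<bar> * (C * (?e t * ?e x))"
        by (rule mult_left_mono) simp
      then show ?thesis using True C(2) by (simp add: abs_mult mult_ac)
    qed auto
    then show "AE z in lborel \<Otimes>\<^sub>M lborel. norm (case_prod ?f z)
        \<le> norm (case z of (t, x) \<Rightarrow> (?e t * g t) * (C * (indicator {0<..} x * ?e x)))"
      by (intro AE_I2) (auto simp only: split_beta real_norm_def)
  qed
  have inner_t: "(LINT t|lborel. ?f t x) = primitive v x * \<psi>' x" for x
  proof -
    have "(LINT t|lborel. ?f t x) = (LINT t|lborel. (indicator {..x} t * g t) * \<psi>' x)"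
    proof (rule integral_cong_AE)
      show "AE t in lborel. ?f t x = (indicator {..x} t * g t) * \<psi>' x"
        using AE_lborel_singleton[of x] by eventually_elim (use g(2) in \<open>auto simp: indicator_def\<close>)
    qed measurable
    also have "\<dots> = (LINT t|HL. indicator {..x} t * v t) * \<psi>' x"
      by (subst repr(1)) auto
    finally show ?thesis by (simp add: primitive_def)
  qed
  have inner_x: "(LINT x|lborel. ?f t x) = - (\<psi> t * g t)" for t
  proof (cases "t > 0")
    case True
    have "(LINT x|lborel. ?f t x) = (LINT x|lborel. g t * (indicator {t<..} x * \<psi>' x))"
      by (rule Bochner_Integration.integral_cong) (use True in \<open>auto simp: indicator_def\<close>)
    then show ?thesis
      using decays_FTC[OF psi, of t] True by (simp add: mult.commute)
  next
    case False
    then show ?thesis using g(2)[of t] by simp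
  qed
  have prim_measurable: "(\<lambda>x. primitive v x * \<psi>' x) \<in> borel_measurable borel"
    unfolding inner_t[symmetric] by measurable
  have prim_neg: "primitive v x = 0" if "x \<le> 0" for x
  proof -
    have "primitive v x = (LINT t|HL. 0)"
      unfolding primitive_def by (rule Bochner_Integration.integral_cong) (use that in auto)
    then show ?thesis by simp
  qed
  have "(LINT x|HL. primitive v x * \<psi>' x) = (LINT x|lborel. primitive v x * \<psi>' x)"
    unfolding integral_HL_lborel[OF prim_measurable]
    by (rule Bochner_Integration.integral_cong) (auto simp: indicator_def prim_neg)
  also have "\<dots> = (LINT x|lborel. LINT t|lborel. ?f t x)"
    unfolding inner_t ..
  also have "\<dots> = (LINT t|lborel. LINT x|lborel. ?f t x)"
    by (rule lborel_pair.Fubini_integral[OF int])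
  also have "\<dots> = - (LINT t|lborel. \<psi> t * g t)"
    unfolding inner_x by simp
  also have "\<dots> = - (LINT t|HL. v t * \<psi> t)"
    by (subst repr(1)[symmetric]) (auto simp: mult.commute)
  finally show ?thesis .
qed

section \<open>Weak derivatives and values at the endpoint\<close>

text \<open>
  An antiderivative of \<open>\<psi>\<close> is constant on either side of the support of
  \<open>\<psi>\<close>. Choosing it to vanish on the right, the vanishing integral makes it
  vanish on the left as well.
\<close>

lemma test_function_antideriv:
  assumes psi: "\<psi> \<in> test_functions" and zero: "(LINT x|HL. \<psi> x) = 0"
  obtains \<phi> where "\<phi> \<in> test_functions" "deriv \<phi> = \<psi>"
proof -
  obtain a b where ab: "smooth \<psi>" "0 < a" "a < b" "\<And>x. x \<notin> {a..b} \<Longrightarrow> \<psi> x = 0"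
    using test_functionsE[OF psi] by blast
  have "isCont \<psi> x" for x
    using smooth_continuous_on[OF ab(1), of UNIV] by (simp add: continuous_on_eq_continuous_at)
  then obtain F where F: "\<And>x. (F has_real_derivative \<psi> x) (at x)"
    using einterval_antiderivative[of "-\<infinity>" "\<infinity>" \<psi>]
    by (auto simp: has_real_derivative_iff_has_vector_derivative)
  define \<phi> where "\<phi> = (\<lambda>x. F x - F b)"
  have der: "(\<phi> has_real_derivative \<psi> x) (at x)" for x
    unfolding \<phi>_def using F[of x] by (auto intro!: derivative_eq_intros)
  have right: "\<phi> x = 0" if "x > b" for x
  proof -
    obtain z where "b < z" "\<phi> x - \<phi> b = (x - b) * \<psi> z"
      using MVT2[of b x \<phi> \<psi>] \<open>b < x\<close> der by blast
    then show ?thesis using ab(4)[of z] by (simp add: \<phi>_def)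
  qed
  have smooth: "smooth \<phi>" by (rule smooth_antideriv[OF der ab(1)])
  have "decays \<phi>"
    by (intro decays_compact[of _ b] smooth_continuous_on smooth right)
  from decays_integral_deriv[OF this decays_test[OF psi] der] zero have zero': "\<phi> 0 = 0" by simp
  \<comment> \<open>The value at 0, known from the integral over the half-line, spreads to \<open>{..<a}\<close>, where
    \<open>\<psi>\<close> vanishes.\<close>
  have left: "\<phi> x = 0" if "x < a" for x
  proof (cases "x = 0")
    case False
    then consider "x < 0" | "0 < x" by linarith
    then show ?thesis
    proof cases
      case 1
      then obtain z where "z < 0" "\<phi> 0 - \<phi> x = (0 - x) * \<psi> z"
        using MVT2[of x 0 \<phi> \<psi>] der by blast
      then show ?thesis using ab(2) ab(4)[of z] zero' by simp
    next
      case 2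
      then obtain z where "z < x" "\<phi> x - \<phi> 0 = (x - 0) * \<psi> z"
        using MVT2[of 0 x \<phi> \<psi>] der by blast
      then show ?thesis using ab(4)[of z] zero' that by simp
    qed
  qed (use zero' in simp)
  show ?thesis
  proof (rule that)
    show "\<phi> \<in> test_functions"
      by (rule test_functionsI[OF smooth ab(2)]) (use left right in \<open>auto simp: not_le\<close>)
    show "deriv \<phi> = \<psi>" by (rule ext) (rule DERIV_imp_deriv[OF der])
  qed
qed

text \<open>
  Otherwise the fundamental lemma would show that the constant function 1 vanishes.
\<close>

lemma test_function_nonzero_integral:
  obtains \<eta> where "\<eta> \<in> test_functions" "(LINT x|HL. \<eta> x) \<noteq> 0"
proof -
  have "\<exists>\<eta>\<in>test_functions. (LINT x|HL. \<eta> x) \<noteq> 0"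
  proof (rule ccontr)
    assume "\<not> ?thesis"
    then have "AE x in HL. (1::real) = 0"
      by (intro fundamental_lemma continuous_locally_integrable) auto
    then have "AE x in lebesgue. x \<in> {..0::real}"
      unfolding AE_HL_iff by (auto simp: not_less)
    then have "(1::real) \<in> {..0}" by (intro mem_closed_if_AE_lebesgue) auto
    then show False by simp
  qed
  then show ?thesis using that by blast
qed

lemma test_integrable: "\<phi> \<in> test_functions \<Longrightarrow> integrable HL \<phi>"
  by (intro decays_integrable decays_test)

text \<open>
  Subtracting a multiple of a fixed \<open>\<eta>\<close> from a test function
  \<open>\<psi>\<close> makes the integral of \<open>\<psi>\<close> zero, so the difference is the
  derivative of a test function. Hence \<open>h\<close> acts on \<open>\<psi>\<close> as
  integration against a constant \<open>c\<close>, and the fundamental lemma applies to \<open>h -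
  c\<close>.
\<close>

lemma du_Bois_Reymond:
  assumes h: "locally_integrable h"
    and zero: "\<And>\<phi>. \<phi> \<in> test_functions \<Longrightarrow> (LINT x|HL. h x * deriv \<phi> x) = 0"
  shows "\<exists>c. AE x in HL. h x = c"
proof -
  obtain \<eta> where eta: "\<eta> \<in> test_functions" "(LINT x|HL. \<eta> x) \<noteq> 0"
    by (rule test_function_nonzero_integral)
  define c where "c = (LINT x|HL. h x * \<eta> x) / (LINT x|HL. \<eta> x)"
  have "AE x in HL. h x - c = 0"
  proof (rule fundamental_lemma)
    show "locally_integrable (\<lambda>x. h x - c)"
      by (intro locally_integrable_diff h continuous_locally_integrable) auto
    fix \<psi> assume psi: "\<psi> \<in> test_functions"
    define d where "d = (LINT x|HL. \<psi> x) / (LINT x|HL. \<eta> x)"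
    have "(LINT x|HL. \<psi> x - d * \<eta> x) = 0"
      using eta psi by (simp add: test_integrable d_def)
    then obtain \<phi> where phi: "\<phi> \<in> test_functions" "deriv \<phi> = (\<lambda>x. \<psi> x - d * \<eta> x)"
      using test_function_antideriv[OF test_function_diff_scale[OF psi eta(1)]] by metis
    have "0 = (LINT x|HL. h x * \<psi> x - d * (h x * \<eta> x))"
      using zero[OF phi(1)] unfolding phi(2) by (simp add: algebra_simps)
    also have "\<dots> = (LINT x|HL. h x * \<psi> x) - d * (LINT x|HL. h x * \<eta> x)"
      using locally_integrable_times_test[OF h psi] locally_integrable_times_test[OF h eta(1)] by simp
    also have "d * (LINT x|HL. h x * \<eta> x) = c * (LINT x|HL. \<psi> x)"
      by (simp add: d_def c_def)
    finally show "(LINT x|HL. (h x - c) * \<psi> x) = 0"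
      using locally_integrable_times_test[OF h psi] test_integrable[OF psi]
      by (simp add: left_diff_distrib)
  qed
  then show ?thesis by (intro exI[of _ c]) simp
qed

text \<open>
  Integration by parts shows that \<open>u\<close> and \<open>primitive v\<close> have the same
  weak derivative, so they differ by a constant. This constant is the value of \<open>u\<close> at
  0.
\<close>

lemma primitive_representation:
  assumes uv: "u \<in> L2" "v \<in> L2"
    and weak: "\<And>\<phi>. \<phi> \<in> test_functions \<Longrightarrow> (LINT x|HL. u x * deriv \<phi> x) = - (LINT x|HL. v x * \<phi> x)"
  shows "\<exists>c. AE x in HL. u x = c + primitive v x"
proof -
  have prim: "locally_integrable (primitive v)"
    by (intro continuous_locally_integrable continuous_on_primitive uv)
  have "\<exists>c. AE x in HL. u x - primitive v x = c"
  proof (rule du_Bois_Reymond)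
    show "locally_integrable (\<lambda>x. u x - primitive v x)"
      by (intro locally_integrable_diff L2_locally_integrable uv prim)
    fix \<phi> assume phi: "\<phi> \<in> test_functions"
    then have phi': "deriv \<phi> \<in> test_functions" by (rule test_function_deriv)
    have smooth: "smooth \<phi>" using test_functionsE[OF phi] by blast
    have "(LINT x|HL. primitive v x * deriv \<phi> x) = - (LINT x|HL. v x * \<phi> x)"
      using integration_by_parts[OF uv(2) decays_test[OF phi] decays_test[OF phi'] smooth_has_deriv[OF smooth]] .
    then show "(LINT x|HL. (u x - primitive v x) * deriv \<phi> x) = 0"
      using weak[OF phi] locally_integrable_times_test[OF prim phi']
        locally_integrable_times_test[OF L2_locally_integrable[OF uv(1)] phi']
      by (simp add: left_diff_distrib)
  qed
  then show ?thesis by (auto simp: algebra_simps)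
qed

lemma has_weak_deriv_integral:
  "has_weak_deriv k u v \<Longrightarrow> \<phi> \<in> test_functions \<Longrightarrow>
    (LINT x|HL. u x * (deriv ^^ k) \<phi> x) = (-1) ^ k * (LINT x|HL. v x * \<phi> x)"
  unfolding has_weak_deriv_def by blast

lemma has_weak_deriv_unique:
  assumes "has_weak_deriv k u v" "has_weak_deriv k u w"
  shows "AE x in HL. v x = w x"
proof -
  have loc: "locally_integrable v" "locally_integrable w"
    using assms unfolding has_weak_deriv_def by auto
  have "AE x in HL. v x - w x = 0"
  proof (rule fundamental_lemma)
    fix \<phi> assume phi: "\<phi> \<in> test_functions"
    have "(-1) ^ k * (LINT x|HL. v x * \<phi> x) = (-1) ^ k * (LINT x|HL. w x * \<phi> x)"
      using assms[THEN has_weak_deriv_integral, OF phi] by simp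
    then show "(LINT x|HL. (v x - w x) * \<phi> x) = 0"
      using loc[THEN locally_integrable_times_test, OF phi] by (simp add: left_diff_distrib)
  qed (intro locally_integrable_diff loc)
  then show ?thesis by simp
qed

lemma weak_deriv_AE:
  assumes "has_weak_deriv k u v"
  shows "AE x in HL. weak_deriv k u x = v x"
  unfolding weak_deriv_def by (rule has_weak_deriv_unique[OF someI[of "has_weak_deriv k u", OF assms] assms])

lemma has_weak_deriv_diff:
  assumes "has_weak_deriv k u u'" "has_weak_deriv k w w'"
  shows "has_weak_deriv k (\<lambda>x. u x - w x) (\<lambda>x. u' x - w' x)"
  unfolding has_weak_deriv_def
proof (intro conjI ballI)
  have loc: "locally_integrable u" "locally_integrable u'" "locally_integrable w" "locally_integrable w'"
    using assms unfolding has_weak_deriv_def by auto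
  then show "locally_integrable (\<lambda>x. u x - w x)" "locally_integrable (\<lambda>x. u' x - w' x)"
    by (auto intro: locally_integrable_diff)
  fix \<phi> assume phi: "\<phi> \<in> test_functions"
  then have phik: "(deriv ^^ k) \<phi> \<in> test_functions" by (rule test_function_funpow_deriv)
  show "(LINT x|HL. (u x - w x) * (deriv ^^ k) \<phi> x) = (-1) ^ k * (LINT x|HL. (u' x - w' x) * \<phi> x)"
    using assms[THEN has_weak_deriv_integral, OF phi] loc[THEN locally_integrable_times_test, OF phi]
      loc[THEN locally_integrable_times_test, OF phik]
    by (simp add: left_diff_distrib right_diff_distrib)
qed

lemma sobolev_weak_deriv:
  assumes "u \<in> sobolev n" "k \<le> n"
  shows "weak_deriv k u \<in> L2" "has_weak_deriv k u (weak_deriv k u)"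
proof -
  obtain v where v: "v \<in> L2" "has_weak_deriv k u v"
    using assms unfolding sobolev_def by blast
  show "has_weak_deriv k u (weak_deriv k u)"
    unfolding weak_deriv_def by (rule someI[of "has_weak_deriv k u", OF v(2)])
  show "weak_deriv k u \<in> L2"
    by (rule L2_AE[OF v(1)]) (use weak_deriv_AE[OF v(2)] in \<open>auto elim: eventually_mono\<close>)
qed

lemma sobolev_diff:
  assumes "u \<in> sobolev n" "w \<in> sobolev n"
  shows "(\<lambda>x. u x - w x) \<in> sobolev n"
proof -
  have "\<exists>v\<in>L2. has_weak_deriv k (\<lambda>x. u x - w x) v" if "k \<le> n" for k
    using has_weak_deriv_diff L2_diff sobolev_weak_deriv[OF assms(1) that]
      sobolev_weak_deriv[OF assms(2) that] by blast
  then show ?thesis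
    using assms unfolding sobolev_def by (auto intro: L2_diff)
qed

lemma weak_deriv_diff_AE:
  assumes "u \<in> sobolev n" "w \<in> sobolev n" "k \<le> n"
  shows "AE x in HL. weak_deriv k (\<lambda>x. u x - w x) x = weak_deriv k u x - weak_deriv k w x"
  by (intro weak_deriv_AE has_weak_deriv_diff sobolev_weak_deriv(2)[OF _ assms(3)] assms)

text \<open>
  The weak derivatives of orders \<open>k\<close> and \<open>Suc k\<close> are both defined
  relative to \<open>u\<close>. Using the derivative of a test function in the definition for
  order \<open>k\<close> relates them to each other.
\<close>

lemma sobolev_primitive:
  assumes u: "u \<in> sobolev n" and k: "k < n"
  shows "\<exists>c. AE x in HL. weak_deriv k u x = c + primitive (weak_deriv (Suc k) u) x"
proof (rule primitive_representation)
  have k': "k \<le> n" "Suc k \<le> n" using k by auto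
  note D = sobolev_weak_deriv[OF u k'(1)] sobolev_weak_deriv[OF u k'(2)]
  show "weak_deriv k u \<in> L2" "weak_deriv (Suc k) u \<in> L2" by (rule D)+
  fix \<phi> assume phi: "\<phi> \<in> test_functions"
  have "(-1) ^ k * (LINT x|HL. weak_deriv k u x * deriv \<phi> x)
      = (LINT x|HL. u x * (deriv ^^ k) (deriv \<phi>) x)"
    using has_weak_deriv_integral[OF D(2) test_function_deriv[OF phi]] by simp
  also have "\<dots> = (LINT x|HL. u x * (deriv ^^ Suc k) \<phi> x)"
    by (simp only: funpow_Suc_right o_apply)
  also have "\<dots> = (-1) ^ Suc k * (LINT x|HL. weak_deriv (Suc k) u x * \<phi> x)"
    by (rule has_weak_deriv_integral[OF D(4) phi])
  finally have "(-1) ^ k * (LINT x|HL. weak_deriv k u x * deriv \<phi> x)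
      = (-1) ^ k * (- (LINT x|HL. weak_deriv (Suc k) u x * \<phi> x))"
    by simp
  then show "(LINT x|HL. weak_deriv k u x * deriv \<phi> x) = - (LINT x|HL. weak_deriv (Suc k) u x * \<phi> x)"
    by (rule mult_left_cancel[THEN iffD1, rotated]) simp
qed

lemma has_value_primitive:
  assumes "v \<in> L2" "AE x in HL. u x = c + primitive v x"
  shows "has_value_at_0 u c"
  unfolding has_value_at_0_def
  by (intro exI[of _ "\<lambda>x. c + primitive v x"] conjI continuous_intros continuous_on_primitive assms) simp

section \<open>Laguerre functions\<close>

definition exp_poly :: "real \<Rightarrow> real poly \<Rightarrow> real \<Rightarrow> real" where
  "exp_poly \<beta> p x = exp (- (1/2) * \<beta> * x) * poly p x"

text \<open>
  The derivative of \<open>exp (- \<beta> x / 2) p\<close> is again such a function; this is its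
  effect on \<open>p\<close>.
\<close>

definition exp_poly_deriv :: "real \<Rightarrow> real poly \<Rightarrow> real poly" where
  "exp_poly_deriv \<beta> p = pderiv p - smult (\<beta> / 2) p"

lemma laguerre_space_eq: "laguerre_space \<beta> N = {exp_poly \<beta> p | p. degree p \<le> N}"
  by (simp add: laguerre_space_def exp_poly_def[abs_def])

lemma exp_poly_linear:
  "exp_poly \<beta> (p + q) x = exp_poly \<beta> p x + exp_poly \<beta> q x" "exp_poly \<beta> (p - q) x = exp_poly \<beta> p x - exp_poly \<beta> q x"
  "exp_poly \<beta> (smult a p) x = a * exp_poly \<beta> p x" "exp_poly \<beta> 0 x = 0" "exp_poly \<beta> p 0 = poly p 0"
  by (simp_all add: exp_poly_def algebra_simps)

lemma exp_poly_has_deriv: "(exp_poly \<beta> p has_real_derivative exp_poly \<beta> (exp_poly_deriv \<beta> p) x) (at x)"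
proof -
  have "((\<lambda>x. exp (- (1/2) * \<beta> * x) * poly p x) has_real_derivative exp_poly \<beta> (exp_poly_deriv \<beta> p) x) (at x)"
    unfolding exp_poly_def exp_poly_deriv_def
    by (auto intro!: derivative_eq_intros simp: algebra_simps)
  then show ?thesis by (simp add: exp_poly_def[abs_def])
qed

lemma funpow_exp_poly_deriv_linear:
  "(exp_poly_deriv \<beta> ^^ k) (p + q) = (exp_poly_deriv \<beta> ^^ k) p + (exp_poly_deriv \<beta> ^^ k) q"
  "(exp_poly_deriv \<beta> ^^ k) (smult a p) = smult a ((exp_poly_deriv \<beta> ^^ k) p)"
  by (induction k) (simp_all add: exp_poly_deriv_def pderiv_add pderiv_smult smult_add_right smult_diff_right mult.commute)

lemma decays_scale:
  assumes "decays f" shows "decays (\<lambda>x. c * f x)"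
proof -
  obtain C \<gamma> where f: "0 < \<gamma>" "0 \<le> C" "\<And>x. x \<ge> 0 \<Longrightarrow> \<bar>f x\<bar> \<le> C * exp (- (\<gamma> * x))"
    using decaysE[OF assms] by metis
  have "\<bar>c * f x\<bar> \<le> (\<bar>c\<bar> * C) * exp (- (\<gamma> * x))" if "x \<ge> 0" for x
    using f(3)[OF that] mult_left_mono[of "\<bar>f x\<bar>" "C * exp (- (\<gamma> * x))" "\<bar>c\<bar>"]
    by (simp add: abs_mult mult.assoc)
  moreover have "0 \<le> \<bar>c\<bar> * C" using f by simp
  ultimately show ?thesis
    unfolding decays_def using decays_continuous[OF assms] f(1) by (blast intro: continuous_on_mult_left)
qed

lemma decays_x_exp:
  assumes "0 < \<gamma>" shows "decays (\<lambda>x. x * exp (- (\<gamma> * x)))"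
proof -
  have "\<bar>x * exp (- (\<gamma> * x))\<bar> \<le> (2 / \<gamma>) * exp (- ((\<gamma> / 2) * x))" if "x \<ge> 0" for x
  proof -
    have "\<gamma> / 2 * x \<le> exp (\<gamma> / 2 * x)"
      using exp_ge_add_one_self[of "\<gamma> / 2 * x"] by linarith
    then have "x \<le> 2 / \<gamma> * exp (\<gamma> / 2 * x)" using assms by (simp add: field_simps)
    then have "x * exp (- (\<gamma> * x)) \<le> (2 / \<gamma> * exp (\<gamma> / 2 * x)) * exp (- (\<gamma> * x))"
      by (rule mult_right_mono) simp
    also have "\<dots> = (2 / \<gamma>) * exp (- ((\<gamma> / 2) * x))"
      by (simp add: mult_exp_exp)
    finally show ?thesis using that by (simp add: abs_mult)
  qed
  moreover have "0 < \<gamma> / 2" "0 \<le> 2 / \<gamma>" using assms by auto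
  moreover have "continuous_on UNIV (\<lambda>x. x * exp (- (\<gamma> * x)))" by (intro continuous_intros)
  ultimately show ?thesis unfolding decays_def by blast
qed

lemma decays_poly_exp: "0 < \<gamma> \<Longrightarrow> decays (\<lambda>x. poly p x * exp (- (\<gamma> * x)))"
proof (induction p arbitrary: \<gamma>)
  case 0
  show ?case using decays_scale[OF decays_exp[OF 0], of 0] by simp
next
  case (pCons a p)
  have "decays (\<lambda>x. a * exp (- (\<gamma> * x)) +
      (x * exp (- (\<gamma> / 2 * x))) * (poly p x * exp (- (\<gamma> / 2 * x))))"
    using pCons.prems
    by (intro decays_add decays_scale decays_exp decays_mult decays_x_exp pCons.IH) auto
  moreover have "a * exp (- (\<gamma> * x)) + (x * exp (- (\<gamma> / 2 * x))) * (poly p x * exp (- (\<gamma> / 2 * x)))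
      = poly (pCons a p) x * exp (- (\<gamma> * x))" for x
  proof -
    have "exp (- (\<gamma> * x)) = exp (- (\<gamma> / 2 * x)) * exp (- (\<gamma> / 2 * x))"
      by (simp add: mult_exp_exp)
    then show ?thesis by (simp add: algebra_simps)
  qed
  ultimately show ?case by simp
qed

lemma decays_exp_poly: "0 < \<beta> \<Longrightarrow> decays (exp_poly \<beta> p)"
  using decays_poly_exp[of "\<beta> / 2" p] by (simp add: exp_poly_def[abs_def] mult.commute)

lemma L2_exp_poly: "0 < \<beta> \<Longrightarrow> exp_poly \<beta> p \<in> L2"
  by (intro L2_decays decays_exp_poly)

lemma integral_exp_poly_test:
  assumes "0 < \<beta>" "\<phi> \<in> test_functions"
  shows "(LINT x|HL. exp_poly \<beta> p x * deriv \<phi> x) = - (LINT x|HL. exp_poly \<beta> (exp_poly_deriv \<beta> p) x * \<phi> x)"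
proof -
  obtain a b where phi: "smooth \<phi>" "0 < a" "\<And>x. x \<notin> {a..b} \<Longrightarrow> \<phi> x = 0"
    using test_functionsE[OF assms(2)] by blast
  note d = decays_exp_poly[OF assms(1)] decays_test[OF assms(2)]
    decays_test[OF test_function_deriv[OF assms(2)]]
  have "(LINT x|HL. exp_poly \<beta> (exp_poly_deriv \<beta> p) x * \<phi> x + exp_poly \<beta> p x * deriv \<phi> x) = - (exp_poly \<beta> p 0 * \<phi> 0)"
  proof (rule decays_integral_deriv)
    show "((\<lambda>x. exp_poly \<beta> p x * \<phi> x) has_real_derivative
        exp_poly \<beta> (exp_poly_deriv \<beta> p) x * \<phi> x + exp_poly \<beta> p x * deriv \<phi> x) (at x)" for x
      using DERIV_mult[OF exp_poly_has_deriv smooth_has_deriv[OF phi(1)], of \<beta> p x]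
      by (simp add: mult.commute add.commute)
  qed (intro decays_add decays_mult d)+
  moreover have "\<phi> 0 = 0" using phi(2) phi(3)[of 0] by auto
  ultimately show ?thesis
    by (simp add: decays_integrable decays_mult d)
qed

lemma has_weak_deriv_exp_poly:
  assumes "0 < \<beta>"
  shows "has_weak_deriv k (exp_poly \<beta> p) (exp_poly \<beta> ((exp_poly_deriv \<beta> ^^ k) p))"
  unfolding has_weak_deriv_def
proof (intro conjI ballI)
  show "locally_integrable (exp_poly \<beta> p)" "locally_integrable (exp_poly \<beta> ((exp_poly_deriv \<beta> ^^ k) p))"
    by (intro L2_locally_integrable L2_decays decays_exp_poly assms)+
  fix \<phi> assume phi: "\<phi> \<in> test_functions"
  show "(LINT x|HL. exp_poly \<beta> p x * (deriv ^^ k) \<phi> x)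
      = (-1) ^ k * (LINT x|HL. exp_poly \<beta> ((exp_poly_deriv \<beta> ^^ k) p) x * \<phi> x)"
  proof (induction k arbitrary: p)
    case (Suc k)
    show ?case
      using integral_exp_poly_test[OF assms test_function_funpow_deriv[OF phi], of p k]
        Suc.IH[of "exp_poly_deriv \<beta> p"] by (simp add: funpow_swap1)
  qed simp
qed

lemma sobolev_exp_poly: "0 < \<beta> \<Longrightarrow> exp_poly \<beta> p \<in> sobolev n"
  unfolding sobolev_def using has_weak_deriv_exp_poly L2_decays decays_exp_poly by blast

lemma exp_poly_primitive:
  assumes "0 < \<beta>" "0 \<le> x"
  shows "exp_poly \<beta> p x = poly p 0 + primitive (exp_poly \<beta> (exp_poly_deriv \<beta> p)) x"
proof -
  let ?f = "exp_poly \<beta> (exp_poly_deriv \<beta> p)"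
  note d = decays_exp_poly[OF assms(1)]
  have [measurable]: "?f \<in> borel_measurable borel" by (rule decays_measurable[OF d])
  have "primitive ?f x = (LINT t|lborel. indicator {0<..} t * (indicator {..x} t * ?f t))"
    unfolding primitive_def by (rule integral_HL_lborel) measurable
  also have "\<dots> = (LINT t|lborel. indicator {0<..} t * ?f t - indicator {x<..} t * ?f t)"
    by (rule Bochner_Integration.integral_cong) (use assms(2) in \<open>auto simp: indicator_def\<close>)
  also have "\<dots> = - exp_poly \<beta> p 0 - - exp_poly \<beta> p x"
    using decays_FTC[OF d d exp_poly_has_deriv, of 0 p] decays_FTC[OF d d exp_poly_has_deriv assms(2), of p]
      decays_lborel_integrable[OF d assms(2)] decays_lborel_integrable[OF d order_refl]
    by simp
  finally show ?thesis by (simp add: exp_poly_linear)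
qed

text \<open>
  A nonzero polynomial has finitely many roots, which form a null set.
\<close>

lemma AE_exp_poly_zero:
  assumes "AE x in HL. exp_poly \<beta> p x = 0" shows "p = 0"
proof (rule ccontr)
  assume "p \<noteq> 0"
  then have "finite {x. poly p x = 0}" by (rule poly_roots_finite)
  then have "{x. poly p x = 0} \<in> null_sets lborel" by (rule finite_imp_null_set_lborel)
  then have "AE x in lebesgue. x \<notin> {x. poly p x = 0}"
    by (intro AE_completion AE_not_in)
  with assms have "AE x in lebesgue. x \<in> {..0::real}"
    unfolding AE_HL_iff by eventually_elim (auto simp: exp_poly_def)
  then have "(1::real) \<in> {..0}" by (intro mem_closed_if_AE_lebesgue) auto
  then show False by simp
qed

section \<open>Moving derivatives in inner products\<close>

lemma L2_inner_cong:
  assumes "f \<in> L2" "g \<in> L2" "AE x in HL. f x = f' x" "AE x in HL. g x = g' x"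
  shows "L2_inner f g = L2_inner f' g'"
  unfolding L2_inner_def
proof (rule integral_cong_AE)
  show "(\<lambda>x. f x * g x) \<in> borel_measurable HL" "(\<lambda>x. f' x * g' x) \<in> borel_measurable HL"
    using assms L2_AE by (blast intro: borel_measurable_times L2_measurable)+
  show "AE x in HL. f x * g x = f' x * g' x"
    using assms(3,4) by eventually_elim simp
qed

lemma L2_inner_diff_left:
  assumes "f \<in> L2" "g \<in> L2" "h \<in> L2"
  shows "L2_inner (\<lambda>x. f x - g x) h = L2_inner f h - L2_inner g h"
  using assms unfolding L2_inner_def by (simp add: left_diff_distrib L2_mult_integrable)

lemma L2_inner_commute: "L2_inner f g = L2_inner g f"
  unfolding L2_inner_def by (simp add: mult.commute)

lemma L2_inner_exp_poly_linear:
  assumes "0 < \<beta>" "f \<in> L2"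
  shows "L2_inner f (exp_poly \<beta> (p + q)) = L2_inner f (exp_poly \<beta> p) + L2_inner f (exp_poly \<beta> q)"
    and "L2_inner f (exp_poly \<beta> (smult a p)) = a * L2_inner f (exp_poly \<beta> p)"
proof -
  have int: "integrable HL (\<lambda>x. f x * exp_poly \<beta> p x)" for p
    using assms by (intro L2_mult_integrable L2_exp_poly)
  show "L2_inner f (exp_poly \<beta> (p + q)) = L2_inner f (exp_poly \<beta> p) + L2_inner f (exp_poly \<beta> q)"
    unfolding L2_inner_def exp_poly_linear distrib_left by (rule Bochner_Integration.integral_add[OF int int])
  have "L2_inner f (exp_poly \<beta> (smult a p)) = (LINT x|HL. a * (f x * exp_poly \<beta> p x))"
    unfolding L2_inner_def exp_poly_linear by (simp add: mult_ac)
  then show "L2_inner f (exp_poly \<beta> (smult a p)) = a * L2_inner f (exp_poly \<beta> p)"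
    by (simp add: L2_inner_def)
qed

lemma L2_inner_exp_poly_sum:
  assumes "0 < \<beta>" "f \<in> L2"
  shows "(\<Sum>i\<in>I. a i * L2_inner f (exp_poly \<beta> (p i))) = L2_inner f (\<lambda>x. \<Sum>i\<in>I. a i * exp_poly \<beta> (p i) x)"
proof -
  have int: "integrable HL (\<lambda>x. f x * exp_poly \<beta> p x)" for p
    using assms by (intro L2_mult_integrable L2_exp_poly)
  have "L2_inner f (\<lambda>x. \<Sum>i\<in>I. a i * exp_poly \<beta> (p i) x)
      = (LINT x|HL. (\<Sum>i\<in>I. a i * (f x * exp_poly \<beta> (p i) x)))"
    unfolding L2_inner_def sum_distrib_left by (simp add: mult_ac)
  also have "\<dots> = (\<Sum>i\<in>I. a i * L2_inner f (exp_poly \<beta> (p i)))"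
    unfolding L2_inner_def
    by (subst Bochner_Integration.integral_sum) (auto intro: int)
  finally show ?thesis by simp
qed

lemma L2_inner_by_parts:
  assumes "0 < \<beta>" "e \<in> L2" "d \<in> L2" "AE x in HL. d x = primitive e x"
  shows "L2_inner e (exp_poly \<beta> q) = - L2_inner d (exp_poly \<beta> (exp_poly_deriv \<beta> q))"
proof -
  have "L2_inner d (exp_poly \<beta> (exp_poly_deriv \<beta> q)) = L2_inner (primitive e) (exp_poly \<beta> (exp_poly_deriv \<beta> q))"
    using assms by (intro L2_inner_cong L2_exp_poly) auto
  also have "\<dots> = - L2_inner e (exp_poly \<beta> q)"
    unfolding L2_inner_def
    by (rule integration_by_parts[OF assms(2) decays_exp_poly[OF assms(1)] decays_exp_poly[OF assms(1)] exp_poly_has_deriv])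
  finally show ?thesis by simp
qed

text \<open>
  If all \<open>d l\<close> with \<open>l < n\<close> vanish at 0, every derivative can be moved
  to the other factor without boundary terms.
\<close>

lemma L2_inner_by_parts_iterated:
  assumes "0 < \<beta>" and d: "\<And>l. l \<le> n \<Longrightarrow> d l \<in> L2"
    and prim: "\<And>l. l < n \<Longrightarrow> AE x in HL. d l x = primitive (d (Suc l)) x"
  shows "k \<le> n \<Longrightarrow> L2_inner (d k) (exp_poly \<beta> q) = (-1) ^ k * L2_inner (d 0) (exp_poly \<beta> ((exp_poly_deriv \<beta> ^^ k) q))"
proof (induction k arbitrary: q)
  case (Suc k)
  have "L2_inner (d (Suc k)) (exp_poly \<beta> q) = - L2_inner (d k) (exp_poly \<beta> (exp_poly_deriv \<beta> q))"
    using Suc.prems by (intro L2_inner_by_parts assms(1) d prim) auto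
  then show ?case using Suc by (simp add: funpow_swap1)
qed simp

section \<open>The differential operator of the form\<close>

lemma pascal_sum:
  fixes c :: real and X :: "nat \<Rightarrow> real"
  shows "(\<Sum>j\<le>m. real (m choose j) * c ^ (m - j) * X (Suc j)) + c * (\<Sum>j\<le>m. real (m choose j) * c ^ (m - j) * X j)
    = (\<Sum>j\<le>Suc m. real (Suc m choose j) * c ^ (Suc m - j) * X j)"
proof -
  have "c * (\<Sum>j\<le>m. real (m choose j) * c ^ (m - j) * X j)
      = (\<Sum>j\<le>m. real (m choose j) * c ^ (Suc m - j) * X j)"
    unfolding sum_distrib_left by (rule sum.cong) (auto simp: Suc_diff_le)
  also have "\<dots> = (\<Sum>j\<le>Suc m. real (m choose j) * c ^ (Suc m - j) * X j)"
    by simp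
  also have "\<dots> = c ^ Suc m * X 0 + (\<Sum>j\<le>m. real (m choose Suc j) * c ^ (m - j) * X (Suc j))"
    by (subst sum.atMost_Suc_shift) simp
  finally have "c * (\<Sum>j\<le>m. real (m choose j) * c ^ (m - j) * X j)
      = c ^ Suc m * X 0 + (\<Sum>j\<le>m. real (m choose Suc j) * c ^ (m - j) * X (Suc j))" .
  moreover have "(\<Sum>j\<le>Suc m. real (Suc m choose j) * c ^ (Suc m - j) * X j)
      = c ^ Suc m * X 0 + (\<Sum>j\<le>m. real (m choose j) * c ^ (m - j) * X (Suc j))
        + (\<Sum>j\<le>m. real (m choose Suc j) * c ^ (m - j) * X (Suc j))"
    by (subst sum.atMost_Suc_shift) (simp add: algebra_simps sum.distrib)
  ultimately show ?thesis by simp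
qed

text \<open>
  The binomial theorem for the commuting operators \<open>S\<close> and multiplication by
  \<open>c\<close>, evaluated at a point.
\<close>

lemma binomial_operator:
  fixes A S :: "real poly \<Rightarrow> real poly"
  assumes add: "\<And>p q. A (p + q) = A p + A q" and smult: "\<And>a p. A (smult a p) = smult a (A p)"
    and A: "\<And>p. A p = S p + smult c p"
  shows "poly ((A ^^ m) p) x = (\<Sum>j\<le>m. real (m choose j) * c ^ (m - j) * poly ((S ^^ j) p) x)"
proof (induction m arbitrary: p)
  case (Suc m)
  have lin: "(A ^^ m) (p + smult a q) = (A ^^ m) p + smult a ((A ^^ m) q)" for p q a
    by (induction m) (simp_all add: add smult)
  have "poly ((A ^^ Suc m) p) x = poly ((A ^^ m) (S p)) x + c * poly ((A ^^ m) p) x"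
    unfolding funpow_Suc_right o_apply A[of p] lin by simp
  also have "\<dots> = (\<Sum>j\<le>Suc m. real (Suc m choose j) * c ^ (Suc m - j) * poly ((S ^^ j) p) x)"
    unfolding Suc.IH pascal_sum[symmetric] by (simp add: funpow_swap1)
  finally show ?case .
qed simp

lemma funpow_degree_drop:
  fixes A :: "real poly \<Rightarrow> real poly"
  assumes "\<And>p. degree (A p) \<le> degree p - 1" "\<And>p. degree p = 0 \<Longrightarrow> A p = 0"
  shows "degree p < m \<Longrightarrow> (A ^^ m) p = 0"
proof (induction m arbitrary: p)
  case (Suc m)
  have zero: "(A ^^ m) 0 = 0" by (induction m) (simp_all add: assms(2))
  show ?case
  proof (cases "degree p = 0")
    case True
    then show ?thesis using zero assms(2) by (simp add: funpow_swap1)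
  next
    case False
    then have "degree (A p) < m" using assms(1)[of p] Suc.prems by linarith
    then show ?thesis using Suc.IH by (simp add: funpow_swap1)
  qed
qed simp

text \<open>
  The form comes from the operator \<open>((\<beta>/2)^2 - D^2)^n\<close>, with \<open>D\<close>
  the derivative. On the polynomial factor, \<open>D\<close> acts as \<open>p' - (\<beta>/2)
  p\<close>, whence \<open>(\<beta>/2)^2 - D^2\<close> acts as \<open>\<beta> p' - p''\<close>.
  This lowers degrees, and so its \<open>n\<close>-th power annihilates polynomials of degree
  below \<open>n\<close>.
\<close>

lemma exp_poly_ode:
  assumes "degree p < n"
  shows "(\<Sum>\<nu>\<le>n. real (n choose \<nu>) * ((\<beta> / 2)\<^sup>2) ^ (n - \<nu>) * ((-1) ^ \<nu> * poly ((exp_poly_deriv \<beta> ^^ (2 * \<nu>)) p) x)) = 0"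
proof -
  define A where "A = (\<lambda>q. smult \<beta> (pderiv q) - pderiv (pderiv q))"
  define S where "S = (\<lambda>q. - exp_poly_deriv \<beta> (exp_poly_deriv \<beta> q))"
  have S: "(S ^^ k) p = smult ((-1) ^ k) ((exp_poly_deriv \<beta> ^^ (2 * k)) p)" for k
  proof (induction k)
    case (Suc k)
    have neg: "exp_poly_deriv \<beta> (smult a q) = smult a (exp_poly_deriv \<beta> q)" for a q
      using funpow_exp_poly_deriv_linear(2)[of 1] by simp
    show ?case using Suc by (simp add: S_def neg)
  qed simp
  have "degree (A q) \<le> degree q - 1" for q
    unfolding A_def
    by (rule degree_diff_le) (auto simp: degree_pderiv intro: order_trans[OF degree_smult_le])
  moreover have "A q = 0" if "degree q = 0" for q
    using that by (auto simp: A_def elim: degree_eq_zeroE)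
  ultimately have "(A ^^ n) p = 0" using assms by (rule funpow_degree_drop)
  then have "0 = poly ((A ^^ n) p) x" by simp
  also have "\<dots> = (\<Sum>j\<le>n. real (n choose j) * ((\<beta> / 2)\<^sup>2) ^ (n - j) * poly ((S ^^ j) p) x)"
  proof (rule binomial_operator)
    show "A q = S q + smult ((\<beta> / 2)\<^sup>2) q" for q
      unfolding A_def S_def exp_poly_deriv_def pderiv_diff pderiv_smult smult_diff_right
      by (rule poly_eqI) (simp only: coeff_add coeff_diff coeff_minus coeff_smult,
          simp add: power2_eq_square field_simps)
  qed (simp_all add: A_def pderiv_add pderiv_smult smult_add_right smult_diff_right mult.commute)
  finally show ?thesis by (simp add: S)
qed

text \<open>
  Since \<open>exp_poly_deriv\<close> plus \<open>\<beta>/2\<close> is the ordinary derivative,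
  the binomial theorem turns the prescribed values into prescribed ordinary derivatives \<open>e
  l\<close> of \<open>p\<close> at 0, which determine its Taylor coefficients. As the
  transformation is triangular with ones on the diagonal, the values \<open>c l\<close> are
  recovered by induction on \<open>l\<close>.
\<close>

lemma exp_poly_initial_values:
  assumes "n \<ge> 1"
  obtains p where "degree p < n" "\<And>l. l < n \<Longrightarrow> poly ((exp_poly_deriv \<beta> ^^ l) p) 0 = c l"
proof -
  define e where "e = (\<lambda>l. \<Sum>j\<le>l. real (l choose j) * (\<beta> / 2) ^ (l - j) * c j)"
  define p where "p = (\<Sum>l<n. monom (e l / fact l) l)"
  have coeff: "coeff p i = (if i < n then e i / fact i else 0)" for i
    by (simp add: p_def coeff_sum if_distrib[of "\<lambda>x. x / _"] cong: if_cong)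
  have deg: "degree p < n"
    using degree_le[of "n - 1" p] assms by (force simp: coeff)
  have pd: "poly ((pderiv ^^ l) p) 0 = e l" if "l < n" for l
    using that by (simp add: poly_0_coeff_0 coeff_higher_pderiv coeff pochhammer_fact[symmetric])
  have op: "poly ((pderiv ^^ l) p) 0
      = (\<Sum>j\<le>l. real (l choose j) * (\<beta> / 2) ^ (l - j) * poly ((exp_poly_deriv \<beta> ^^ j) p) 0)" for l
    by (rule binomial_operator) (simp_all add: pderiv_add pderiv_smult exp_poly_deriv_def)
  have "poly ((exp_poly_deriv \<beta> ^^ l) p) 0 = c l" if "l < n" for l
    using that
  proof (induction l rule: less_induct)
    case (less l)
    have "(\<Sum>j<l. real (l choose j) * (\<beta> / 2) ^ (l - j) * poly ((exp_poly_deriv \<beta> ^^ j) p) 0)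
        = (\<Sum>j<l. real (l choose j) * (\<beta> / 2) ^ (l - j) * c j)"
      using less by (intro sum.cong) auto
    then show ?case
      using op[of l] pd[OF less.prems] by (simp add: e_def lessThan_Suc_atMost[symmetric])
  qed
  then show ?thesis using that deg by blast
qed

section \<open>The projection\<close>

text \<open>
  One Gram-Schmidt step for each degree. The space of polynomials of degree below \<open>N\<close>
  is described by its vanishing coefficients, so that the induction starts from the zero space.
  The induction hypothesis is used twice: to make the new basis vector \<open>e\<close> orthogonal
  to the previous space, and to represent \<open>F\<close> there.
\<close>

lemma orthogonal_projection_exists:
  fixes b :: "real poly \<Rightarrow> real poly \<Rightarrow> real" and F :: "real poly \<Rightarrow> real"
  assumes b: "\<And>p q r. b r (p + q) = b r p + b r q" "\<And>a r p. b r (smult a p) = a * b r p"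
      "\<And>p q. b p q = b q p" "\<And>p. p \<noteq> 0 \<Longrightarrow> b p p > 0"
    and "\<And>p q. F (p + q) = F p + F q" "\<And>a p. F (smult a p) = a * F p"
  shows "\<exists>q. (\<forall>i\<ge>N. coeff q i = 0) \<and> (\<forall>p. (\<forall>i\<ge>N. coeff p i = 0) \<longrightarrow> b q p = F p)"
  using assms(5,6)
proof (induction N arbitrary: F)
  case 0
  have "b 0 p = F p" if "\<forall>i\<ge>0. coeff p i = 0" for p
  proof -
    have "p = 0" using that by (simp add: poly_eq_iff)
    then show ?thesis using b(2)[of 0 0 0] 0(2)[of 0 0] by simp
  qed
  then show ?case by (intro exI[of _ 0]) simp
next
  case (Suc N)
  have b_left: "b (p + q) r = b p r + b q r" "b (smult a p) r = a * b p r" for p q r a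
    using b(1)[of r p q] b(2)[of r a p] b(3) by metis+
  obtain r where r: "\<forall>i\<ge>N. coeff r i = 0" "\<And>p. \<forall>i\<ge>N. coeff p i = 0 \<Longrightarrow> b r p = b (monom 1 N) p"
    using Suc.IH[of "b (monom 1 N)"] b(1,2) by blast
  define e where "e = monom 1 N + smult (-1) r"
  have e: "coeff e N = 1" "\<And>i. i > N \<Longrightarrow> coeff e i = 0" using r(1) by (auto simp: e_def)
  then have "e \<noteq> 0" by auto
  then have pos: "b e e > 0" by (rule b(4))
  have orth: "b e p = 0" if "\<forall>i\<ge>N. coeff p i = 0" for p
    using r(2)[OF that] unfolding e_def b_left by simp
  obtain q where q: "\<forall>i\<ge>N. coeff q i = 0" "\<And>p. \<forall>i\<ge>N. coeff p i = 0 \<Longrightarrow> b q p = F p"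
    using Suc.IH[of F] Suc.prems by blast
  define q' where "q' = q + smult (F e / b e e) e"
  have "b q' p = F p" if p: "\<forall>i\<ge>Suc N. coeff p i = 0" for p
  proof -
    define s where "s = p + smult (- coeff p N) e"
    have s: "\<forall>i\<ge>N. coeff s i = 0"
    proof (intro allI impI)
      fix i assume "i \<ge> N"
      then show "coeff s i = 0" using p e by (cases "i = N") (auto simp: s_def)
    qed
    have p_eq: "p = s + smult (coeff p N) e" by (simp add: s_def)
    have "b q e = 0" using orth[OF q(1)] b(3) by metis
    then have "b q' e = F e" using pos by (simp add: q'_def b_left)
    moreover have "b q' s = F s" using orth[OF s] q(2)[OF s] by (simp add: q'_def b_left)
    ultimately have "b q' (s + smult (coeff p N) e) = F (s + smult (coeff p N) e)"
      by (simp add: b(1,2) Suc.prems)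
    then show ?thesis using p_eq by simp
  qed
  moreover have "\<forall>i\<ge>Suc N. coeff q' i = 0" using q(1) e(2) by (auto simp: q'_def)
  ultimately show ?case by blast
qed

definition form_coeff :: "real \<Rightarrow> nat \<Rightarrow> nat \<Rightarrow> real" where
  "form_coeff \<beta> n \<nu> = real (n choose \<nu>) * (\<beta> ^ (2 * n - 2 * \<nu>) / 2 ^ (2 * n - 2 * \<nu>))"

lemma form_coeff_eq: "form_coeff \<beta> n \<nu> = real (n choose \<nu>) * ((\<beta> / 2)\<^sup>2) ^ (n - \<nu>)"
  by (simp only: form_coeff_def power_divide[symmetric] power_mult[symmetric] diff_mult_distrib2)

text \<open>
  The restriction of the form to Laguerre functions, with classical derivatives in place of chosen
  representatives of the weak ones.
\<close>

definition exp_poly_form :: "real \<Rightarrow> nat \<Rightarrow> real poly \<Rightarrow> real poly \<Rightarrow> real" where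
  "exp_poly_form \<beta> n q p = (\<Sum>\<nu>\<le>n. form_coeff \<beta> n \<nu> *
     L2_inner (exp_poly \<beta> ((exp_poly_deriv \<beta> ^^ \<nu>) q)) (exp_poly \<beta> ((exp_poly_deriv \<beta> ^^ \<nu>) p)))"

lemma sobolev_form_exp_poly:
  assumes "0 < \<beta>" "u \<in> sobolev n"
  shows "sobolev_form \<beta> n u (exp_poly \<beta> p)
    = (\<Sum>\<nu>\<le>n. form_coeff \<beta> n \<nu> * L2_inner (weak_deriv \<nu> u) (exp_poly \<beta> ((exp_poly_deriv \<beta> ^^ \<nu>) p)))"
  unfolding sobolev_form_def form_coeff_def[symmetric] atLeast0AtMost
proof (rule sum.cong[OF refl])
  fix \<nu> assume "\<nu> \<in> {..n}"
  then have nu: "\<nu> \<le> n" by simp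
  show "form_coeff \<beta> n \<nu> * L2_inner (weak_deriv \<nu> u) (weak_deriv \<nu> (exp_poly \<beta> p))
      = form_coeff \<beta> n \<nu> * L2_inner (weak_deriv \<nu> u) (exp_poly \<beta> ((exp_poly_deriv \<beta> ^^ \<nu>) p))"
    using sobolev_weak_deriv(1)[OF assms(2) nu] sobolev_weak_deriv(1)[OF sobolev_exp_poly[OF assms(1)] nu]
      weak_deriv_AE[OF has_weak_deriv_exp_poly[OF assms(1)]]
    by (intro arg_cong2[of _ _ _ _ "(*)"] refl L2_inner_cong) auto
qed

lemma sobolev_form_diff_exp_poly:
  assumes "0 < \<beta>" "u \<in> sobolev n"
  shows "sobolev_form \<beta> n (\<lambda>x. u x - exp_poly \<beta> q x) (exp_poly \<beta> p)
    = sobolev_form \<beta> n u (exp_poly \<beta> p) - exp_poly_form \<beta> n q p"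
  unfolding sobolev_form_exp_poly[OF assms] exp_poly_form_def
    sobolev_form_exp_poly[OF assms(1) sobolev_diff[OF assms(2) sobolev_exp_poly[OF assms(1)]]] sum_subtractf[symmetric]
proof (rule sum.cong[OF refl])
  fix \<nu> assume "\<nu> \<in> {..n}"
  then have nu: "\<nu> \<le> n" by simp
  have lagL2: "exp_poly \<beta> p \<in> L2" for p by (intro L2_decays decays_exp_poly assms)
  note D = sobolev_weak_deriv[OF assms(2) nu]
  have "AE x in HL. weak_deriv \<nu> (\<lambda>x. u x - exp_poly \<beta> q x) x = weak_deriv \<nu> u x - exp_poly \<beta> ((exp_poly_deriv \<beta> ^^ \<nu>) q) x"
    by (intro weak_deriv_AE has_weak_deriv_diff D has_weak_deriv_exp_poly assms)
  then have "L2_inner (weak_deriv \<nu> (\<lambda>x. u x - exp_poly \<beta> q x)) (exp_poly \<beta> ((exp_poly_deriv \<beta> ^^ \<nu>) p))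
      = L2_inner (\<lambda>x. weak_deriv \<nu> u x - exp_poly \<beta> ((exp_poly_deriv \<beta> ^^ \<nu>) q) x) (exp_poly \<beta> ((exp_poly_deriv \<beta> ^^ \<nu>) p))"
    by (intro L2_inner_cong lagL2 sobolev_weak_deriv(1)[OF sobolev_diff[OF assms(2) sobolev_exp_poly[OF assms(1)]] nu]) auto
  also have "\<dots> = L2_inner (weak_deriv \<nu> u) (exp_poly \<beta> ((exp_poly_deriv \<beta> ^^ \<nu>) p))
      - L2_inner (exp_poly \<beta> ((exp_poly_deriv \<beta> ^^ \<nu>) q)) (exp_poly \<beta> ((exp_poly_deriv \<beta> ^^ \<nu>) p))"
    by (intro L2_inner_diff_left D lagL2)
  finally show "form_coeff \<beta> n \<nu> * L2_inner (weak_deriv \<nu> (\<lambda>x. u x - exp_poly \<beta> q x)) (exp_poly \<beta> ((exp_poly_deriv \<beta> ^^ \<nu>) p))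
      = form_coeff \<beta> n \<nu> * L2_inner (weak_deriv \<nu> u) (exp_poly \<beta> ((exp_poly_deriv \<beta> ^^ \<nu>) p))
      - form_coeff \<beta> n \<nu> * L2_inner (exp_poly \<beta> ((exp_poly_deriv \<beta> ^^ \<nu>) q)) (exp_poly \<beta> ((exp_poly_deriv \<beta> ^^ \<nu>) p))"
    by (simp add: right_diff_distrib)
qed

text \<open>
  The summand of order 0 is a positive multiple of the squared norm because \<open>\<beta> >
  0\<close>.
\<close>

lemma exp_poly_form_positive:
  assumes "0 < \<beta>" "p \<noteq> 0" shows "exp_poly_form \<beta> n p p > 0"
proof -
  have int: "integrable HL (\<lambda>x. exp_poly \<beta> q x * exp_poly \<beta> q x)" for q
    by (intro decays_integrable decays_mult decays_exp_poly assms)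
  have nonneg: "L2_inner (exp_poly \<beta> q) (exp_poly \<beta> q) \<ge> 0" for q
    unfolding L2_inner_def by simp
  have "L2_inner (exp_poly \<beta> p) (exp_poly \<beta> p) \<noteq> 0"
  proof
    assume "L2_inner (exp_poly \<beta> p) (exp_poly \<beta> p) = 0"
    then have "AE x in HL. exp_poly \<beta> p x * exp_poly \<beta> p x = 0"
      unfolding L2_inner_def by (subst (asm) integral_nonneg_eq_0_iff_AE[OF int]) auto
    then have "AE x in HL. exp_poly \<beta> p x = 0" by simp
    then show False using AE_exp_poly_zero assms(2) by blast
  qed
  with nonneg[of p] have "L2_inner (exp_poly \<beta> p) (exp_poly \<beta> p) > 0" by linarith
  then have "0 < form_coeff \<beta> n 0 * L2_inner (exp_poly \<beta> ((exp_poly_deriv \<beta> ^^ 0) p)) (exp_poly \<beta> ((exp_poly_deriv \<beta> ^^ 0) p))"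
    using assms(1) by (simp add: form_coeff_eq)
  also have "\<dots> \<le> exp_poly_form \<beta> n p p"
    unfolding exp_poly_form_def
    by (rule member_le_sum) (auto intro!: mult_nonneg_nonneg nonneg simp: form_coeff_eq)
  finally show ?thesis .
qed

lemma exp_poly_form_linear:
  assumes "0 < \<beta>"
  shows "exp_poly_form \<beta> n r (p + q) = exp_poly_form \<beta> n r p + exp_poly_form \<beta> n r q"
    and "exp_poly_form \<beta> n r (smult a p) = a * exp_poly_form \<beta> n r p"
    and "exp_poly_form \<beta> n p q = exp_poly_form \<beta> n q p"
proof -
  have lagL2: "exp_poly \<beta> p \<in> L2" for p by (intro L2_decays decays_exp_poly assms)
  show "exp_poly_form \<beta> n r (p + q) = exp_poly_form \<beta> n r p + exp_poly_form \<beta> n r q"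
    unfolding exp_poly_form_def funpow_exp_poly_deriv_linear L2_inner_exp_poly_linear[OF assms lagL2]
    by (simp add: distrib_left sum.distrib)
  show "exp_poly_form \<beta> n r (smult a p) = a * exp_poly_form \<beta> n r p"
    unfolding exp_poly_form_def funpow_exp_poly_deriv_linear L2_inner_exp_poly_linear[OF assms lagL2]
    by (simp add: sum_distrib_left mult_ac)
  show "exp_poly_form \<beta> n p q = exp_poly_form \<beta> n q p"
    unfolding exp_poly_form_def by (subst L2_inner_commute) (rule refl)
qed

lemma sobolev_form_exp_poly_linear:
  assumes "0 < \<beta>" "u \<in> sobolev n"
  shows "sobolev_form \<beta> n u (exp_poly \<beta> (p + q)) = sobolev_form \<beta> n u (exp_poly \<beta> p) + sobolev_form \<beta> n u (exp_poly \<beta> q)"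
    and "sobolev_form \<beta> n u (exp_poly \<beta> (smult a p)) = a * sobolev_form \<beta> n u (exp_poly \<beta> p)"
  unfolding sobolev_form_exp_poly[OF assms] funpow_exp_poly_deriv_linear sum.distrib[symmetric] sum_distrib_left
  by (auto intro!: sum.cong
      simp: L2_inner_exp_poly_linear[OF assms(1) sobolev_weak_deriv(1)[OF assms(2)]] distrib_left)

lemma projection_exp_poly:
  assumes "0 < \<beta>" "u \<in> sobolev n"
  obtains q where "projection n \<beta> N u = exp_poly \<beta> q"
    "\<And>p. degree p \<le> N \<Longrightarrow> sobolev_form \<beta> n (\<lambda>x. u x - exp_poly \<beta> q x) (exp_poly \<beta> p) = 0"
proof -
  have deg: "degree p \<le> N \<longleftrightarrow> (\<forall>i\<ge>Suc N. coeff p i = 0)" for p :: "real poly"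
  proof
    show "\<forall>i\<ge>Suc N. coeff p i = 0" if "degree p \<le> N"
      using that by (auto intro: coeff_eq_0)
    show "degree p \<le> N" if "\<forall>i\<ge>Suc N. coeff p i = 0"
      using that by (intro degree_le) (auto simp: Suc_le_eq)
  qed
  obtain q where q: "degree q \<le> N" "\<And>p. degree p \<le> N \<Longrightarrow> exp_poly_form \<beta> n q p = sobolev_form \<beta> n u (exp_poly \<beta> p)"
    using orthogonal_projection_exists[of "exp_poly_form \<beta> n" "\<lambda>p. sobolev_form \<beta> n u (exp_poly \<beta> p)" "Suc N",
        OF exp_poly_form_linear[OF assms(1)] exp_poly_form_positive[OF assms(1)] sobolev_form_exp_poly_linear[OF assms]]
    unfolding deg[symmetric] by blast
  have orth: "sobolev_form \<beta> n (\<lambda>x. u x - exp_poly \<beta> q x) (exp_poly \<beta> p) = 0" if "degree p \<le> N" for p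
    using q(2)[OF that] by (simp add: sobolev_form_diff_exp_poly[OF assms])
  have "projection n \<beta> N u = exp_poly \<beta> q"
    unfolding projection_def
  proof (rule the_equality, intro conjI ballI)
    show "exp_poly \<beta> q \<in> laguerre_space \<beta> N" using q(1) by (auto simp: laguerre_space_eq)
    show "sobolev_form \<beta> n (\<lambda>x. u x - exp_poly \<beta> q x) v = 0" if "v \<in> laguerre_space \<beta> N" for v
      using that orth by (auto simp: laguerre_space_eq)
  next
    fix w
    assume w: "w \<in> laguerre_space \<beta> N \<and>
      (\<forall>v\<in>laguerre_space \<beta> N. sobolev_form \<beta> n (\<lambda>x. u x - w x) v = 0)"
    then obtain r where r: "w = exp_poly \<beta> r" "degree r \<le> N" by (auto simp: laguerre_space_eq)
    define s where "s = q + smult (-1) r"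
    have s: "degree s \<le> N"
      unfolding s_def using q(1) r(2) by (intro degree_add_le) (auto intro: order_trans[OF degree_smult_le])
    have "sobolev_form \<beta> n (\<lambda>x. u x - exp_poly \<beta> r x) (exp_poly \<beta> s) = 0"
      using w s unfolding r(1) laguerre_space_eq by blast
    then have "exp_poly_form \<beta> n r s = exp_poly_form \<beta> n q s"
      using q(2)[OF s] by (simp add: sobolev_form_diff_exp_poly[OF assms])
    then have "exp_poly_form \<beta> n s q + (-1) * exp_poly_form \<beta> n s r = 0"
      using exp_poly_form_linear(3)[OF assms(1)] by simp
    then have "exp_poly_form \<beta> n s s = 0"
      by (subst (2) s_def) (simp only: exp_poly_form_linear(1,2)[OF assms(1)])
    then have "s = 0" using exp_poly_form_positive[OF assms(1), of s n] by (cases "s = 0") auto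
    then show "w = exp_poly \<beta> q" by (simp add: s_def r(1))
  qed
  then show ?thesis using that orth by blast
qed

section \<open>Values of the projection at the endpoint\<close>

text \<open>
  Let \<open>z\<close> be the Laguerre function of degree below \<open>n\<close> with the same
  values at 0 as \<open>f\<close>, up to the derivative of order \<open>n - 1\<close>. The
  differences \<open>d l\<close> of the derivatives vanish at 0, so the form pairs \<open>f -
  z\<close> with \<open>z\<close> to zero by parts and by the differential equation for
  \<open>z\<close>. As \<open>f\<close> is orthogonal to \<open>z\<close>, the form vanishes on
  the pair of \<open>z\<close> with itself. So \<open>z = 0\<close>.
\<close>

lemma orthogonal_vanishes_at_0:
  assumes n: "n \<ge> 1" and beta: "0 < \<beta>" and f: "f \<in> sobolev n"
    and orth: "\<And>p. degree p < n \<Longrightarrow> sobolev_form \<beta> n f (exp_poly \<beta> p) = 0"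
    and l: "l < n"
  shows "has_value_at_0 (weak_deriv l f) 0"
proof -
  obtain c where c: "\<And>l. l < n \<Longrightarrow> AE x in HL. weak_deriv l f x = c l + primitive (weak_deriv (Suc l) f) x"
    using sobolev_primitive[OF f] by metis
  obtain p where p: "degree p < n" "\<And>l. l < n \<Longrightarrow> poly ((exp_poly_deriv \<beta> ^^ l) p) 0 = c l"
    using exp_poly_initial_values[OF n] by metis
  have lagL2: "exp_poly \<beta> p \<in> L2" for p by (intro L2_decays decays_exp_poly beta)
  define d where "d = (\<lambda>l x. weak_deriv l f x - exp_poly \<beta> ((exp_poly_deriv \<beta> ^^ l) p) x)"
  have dL2: "d l \<in> L2" if "l \<le> n" for l
    unfolding d_def by (intro L2_diff lagL2 sobolev_weak_deriv(1)[OF f that])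
  have d_prim: "AE x in HL. d l x = primitive (d (Suc l)) x" if "l < n" for l
  proof -
    have "primitive (d (Suc l)) x
        = primitive (weak_deriv (Suc l) f) x - primitive (exp_poly \<beta> ((exp_poly_deriv \<beta> ^^ Suc l) p)) x" for x
      unfolding d_def using that by (intro primitive_diff lagL2 sobolev_weak_deriv(1)[OF f]) simp
    moreover have "AE x in HL. exp_poly \<beta> ((exp_poly_deriv \<beta> ^^ l) p) x
        = c l + primitive (exp_poly \<beta> ((exp_poly_deriv \<beta> ^^ Suc l) p)) x"
      by (rule AE_I2) (use exp_poly_primitive[OF beta] p(2)[OF that] in simp)
    ultimately show ?thesis using c[OF that] unfolding d_def by auto
  qed
  let ?t = "\<lambda>\<nu>. L2_inner (d \<nu>) (exp_poly \<beta> ((exp_poly_deriv \<beta> ^^ \<nu>) p))"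
  have "(\<Sum>\<nu>\<le>n. form_coeff \<beta> n \<nu> * ?t \<nu>)
      = (\<Sum>\<nu>\<le>n. (form_coeff \<beta> n \<nu> * (-1) ^ \<nu>) * L2_inner (d 0) (exp_poly \<beta> ((exp_poly_deriv \<beta> ^^ (2 * \<nu>)) p)))"
  proof (rule sum.cong[OF refl])
    fix \<nu> assume "\<nu> \<in> {..n}"
    then show "form_coeff \<beta> n \<nu> * ?t \<nu> = (form_coeff \<beta> n \<nu> * (-1) ^ \<nu>) *
        L2_inner (d 0) (exp_poly \<beta> ((exp_poly_deriv \<beta> ^^ (2 * \<nu>)) p))"
      using L2_inner_by_parts_iterated[of \<beta> n d \<nu>, OF beta dL2 d_prim]
      by (simp add: funpow_add mult_2)
  qed
  also have "\<dots> = L2_inner (d 0) (\<lambda>x. \<Sum>\<nu>\<le>n. (form_coeff \<beta> n \<nu> * (-1) ^ \<nu>) * exp_poly \<beta> ((exp_poly_deriv \<beta> ^^ (2 * \<nu>)) p) x)"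
    by (rule L2_inner_exp_poly_sum[OF beta dL2]) simp
  also have "(\<lambda>x. \<Sum>\<nu>\<le>n. (form_coeff \<beta> n \<nu> * (-1) ^ \<nu>) * exp_poly \<beta> ((exp_poly_deriv \<beta> ^^ (2 * \<nu>)) p) x) = (\<lambda>x. 0)"
  proof
    fix x
    have "(\<Sum>\<nu>\<le>n. (form_coeff \<beta> n \<nu> * (-1) ^ \<nu>) * exp_poly \<beta> ((exp_poly_deriv \<beta> ^^ (2 * \<nu>)) p) x)
        = exp (- (1/2) * \<beta> * x) * (\<Sum>\<nu>\<le>n. real (n choose \<nu>) * ((\<beta> / 2)\<^sup>2) ^ (n - \<nu>) *
            ((-1) ^ \<nu> * poly ((exp_poly_deriv \<beta> ^^ (2 * \<nu>)) p) x))"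
      unfolding sum_distrib_left by (simp add: exp_poly_def form_coeff_eq mult_ac)
    then show "(\<Sum>\<nu>\<le>n. (form_coeff \<beta> n \<nu> * (-1) ^ \<nu>) * exp_poly \<beta> ((exp_poly_deriv \<beta> ^^ (2 * \<nu>)) p) x) = 0"
      using exp_poly_ode[OF p(1)] by simp
  qed
  finally have d_sum: "(\<Sum>\<nu>\<le>n. form_coeff \<beta> n \<nu> * ?t \<nu>) = 0"
    by (simp add: L2_inner_def)
  have "0 = sobolev_form \<beta> n f (exp_poly \<beta> p)" using orth[OF p(1)] by simp
  also have "\<dots> = (\<Sum>\<nu>\<le>n. form_coeff \<beta> n \<nu> * ?t \<nu>) + exp_poly_form \<beta> n p p"
    unfolding sobolev_form_exp_poly[OF beta f] exp_poly_form_def sum.distrib[symmetric]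
  proof (rule sum.cong[OF refl])
    fix \<nu> assume "\<nu> \<in> {..n}"
    then have "?t \<nu> = L2_inner (weak_deriv \<nu> f) (exp_poly \<beta> ((exp_poly_deriv \<beta> ^^ \<nu>) p))
        - L2_inner (exp_poly \<beta> ((exp_poly_deriv \<beta> ^^ \<nu>) p)) (exp_poly \<beta> ((exp_poly_deriv \<beta> ^^ \<nu>) p))"
      unfolding d_def by (intro L2_inner_diff_left lagL2 sobolev_weak_deriv(1)[OF f]) simp
    then show "form_coeff \<beta> n \<nu> * L2_inner (weak_deriv \<nu> f) (exp_poly \<beta> ((exp_poly_deriv \<beta> ^^ \<nu>) p))
        = form_coeff \<beta> n \<nu> * ?t \<nu> + form_coeff \<beta> n \<nu> *
          L2_inner (exp_poly \<beta> ((exp_poly_deriv \<beta> ^^ \<nu>) p)) (exp_poly \<beta> ((exp_poly_deriv \<beta> ^^ \<nu>) p))"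
      by (simp add: right_diff_distrib)
  qed
  finally have "exp_poly_form \<beta> n p p = 0" using d_sum by simp
  then have "p = 0" using exp_poly_form_positive[OF beta, of p n] by (cases "p = 0") auto
  then have "c l = 0"
    using p(2)[OF l] funpow_exp_poly_deriv_linear(2)[of l \<beta> 0 0] by simp
  then show ?thesis
    using has_value_primitive[OF sobolev_weak_deriv(1)[OF f] c[OF l]] l by simp
qed

theorem mainTheorem8:
  fixes n N :: nat and \<beta> :: real and u :: "real \<Rightarrow> real"
  assumes "n \<ge> 1" and "\<beta> > 0" and "u \<in> sobolev n" and "N \<ge> n"
  shows "(\<forall>l<n. \<exists>c. has_value_at_0 (weak_deriv l (projection n \<beta> N u)) c \<and>
                     has_value_at_0 (weak_deriv l u) c) \<and>
         (\<lambda>x. u x - projection n \<beta> N u x) \<in> sobolev_0 n"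
proof -
  obtain q where q: "projection n \<beta> N u = exp_poly \<beta> q"
    "\<And>p. degree p \<le> N \<Longrightarrow> sobolev_form \<beta> n (\<lambda>x. u x - exp_poly \<beta> q x) (exp_poly \<beta> p) = 0"
    using projection_exp_poly[OF assms(2,3)] by metis
  let ?f = "\<lambda>x. u x - exp_poly \<beta> q x"
  have f: "?f \<in> sobolev n"
    by (rule sobolev_diff[OF assms(3) sobolev_exp_poly[OF assms(2)]])
  have val: "has_value_at_0 (weak_deriv l ?f) 0" if "l < n" for l
    using assms(4) by (intro orthogonal_vanishes_at_0[OF assms(1,2) f _ that] q(2)) simp
  have "\<exists>c. has_value_at_0 (weak_deriv l (exp_poly \<beta> q)) c \<and> has_value_at_0 (weak_deriv l u) c"
    if l: "l < n" for l
  proof (intro exI conjI)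
    let ?z = "exp_poly \<beta> ((exp_poly_deriv \<beta> ^^ l) q)"
    have z: "continuous_on {0..} ?z" "AE x in HL. weak_deriv l (exp_poly \<beta> q) x = ?z x"
      using decays_continuous[OF decays_exp_poly] weak_deriv_AE[OF has_weak_deriv_exp_poly] assms(2) by blast+
    then show "has_value_at_0 (weak_deriv l (exp_poly \<beta> q)) (?z 0)"
      unfolding has_value_at_0_def by blast
    obtain g where g: "continuous_on {0..} g" "AE x in HL. weak_deriv l ?f x = g x" "g 0 = 0"
      using val[OF l] unfolding has_value_at_0_def by blast
    have "AE x in HL. weak_deriv l ?f x = weak_deriv l u x - weak_deriv l (exp_poly \<beta> q) x"
      using l by (intro weak_deriv_diff_AE[of _ n] assms(3) sobolev_exp_poly assms(2)) simp
    with g(2) z(2) have "AE x in HL. weak_deriv l u x = g x + ?z x"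
      by eventually_elim simp
    then show "has_value_at_0 (weak_deriv l u) (?z 0)"
      unfolding has_value_at_0_def
      using g(1,3) z(1) by (intro exI[of _ "\<lambda>x. g x + ?z x"]) (auto intro: continuous_on_add)
  qed
  then show ?thesis
    unfolding q(1) sobolev_0_def using f val by blast
qed

end
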